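(* The MWX element method: find $u_{h0}\in V_{h0}$ such that $$\varepsilon^2a_h(u_{h0},v_h)+b_h(u_{h0},v_h)=(f,P_hv_h)\qquad\forall\,v_h\in V_{h0},$$ is equivalent to: find $w_h\in W_h$ and $u_{h0}\in V_{h0}$ such that $$(\nabla w_h,\nabla\chi_h)=(f,\chi_h)\qquad\forall\,\chi_h\in W_h,$$ $$\varepsilon^2a_h(u_{h0},v_h)+b_h(u_{h0},v_h)=(\nabla w_h,\nabla_hv_h)\qquad\forall\,v_h\in V_{h0}.$$
   Context: $\Omega\subset\mathbb R^d$, $d\ge2$, is a convex bounded polytope, $f\in L^2(\Omega)$, $\varepsilon>0$, $\mathcal T_h$ is a (shape regular) simplicial triangulation of $\Omega$, $(\cdot,\cdot)$ the $L^2(\Omega)$ inner product, $n$ the unit outward normal to $\partial\Omega$, and $\nabla_h,\nabla_h^2$ the elementwise gradient and Hessian. $\widetilde V_h$ (global MWX space) is the set of all piecewise quadratic functions on $\mathcal T_h$ whose integral average over each $(d-2)$-dimensional face of elements is continuous (the same from all elements containing that face; for $d=2$ the value at vertices), and whose normal derivative is continuous at the barycenter of each $(d-1)$-dimensional face. $V_h:=\{v\in\widetilde V_h:\int_ev\,ds=0$ for all $(d-2)$-dimensional faces $e\subset\partial\Omega\}$; $V_{h0}:=\{v\in V_h:\int_F\partial_nv\,ds=0$ for all $(d-1)$-dimensional faces $F\subset\partial\Omega\}$. $W_h:=\{v\in H_0^1(\Omega):v|_K\in\mathbb P_\ell(K)\ \forall K\in\mathcal T_h\}$, $\ell\in\{1,2\}$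 fixed. $a_h(w,v):=(\nabla_h^2w,\nabla_h^2v)$, $b_h(w,v):=(\nabla_hw,\nabla_hv)$; $P_h$ maps piecewise $H^1$ functions to $W_h$ by $(\nabla P_hv,\nabla\chi_h)=(\nabla_hv,\nabla\chi_h)$ for all $\chi_h\in W_h$. *)

theory Defs
  imports "HOL-Analysis.Analysis"
begin

section \<open>Geometry of the mesh\<close>

definition simplicial_triangulation :: "'a::euclidean_space set \<Rightarrow> 'a set set \<Rightarrow> bool" where
  "simplicial_triangulation \<Omega> \<T> \<longleftrightarrow>
     triangulation \<T> \<and> (\<forall>K\<in>\<T>. int DIM('a) simplex K) \<and> \<Union>\<T> = closure \<Omega>"

definition shape_regular :: "real \<Rightarrow> 'a::euclidean_space set set \<Rightarrow> bool" where
  "shape_regular \<gamma> \<T> \<longleftrightarrow>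
     (\<forall>K\<in>\<T>. \<exists>x r. 0 < r \<and> cball x r \<subseteq> K \<and> diameter K \<le> \<gamma> * r)"

text \<open>Faces of codimension \<open>k\<close> of an element.  Vertices are the faces of dimension 0; since
  \<^const>\<open>aff_dim\<close> of the empty set is -1, the empty face does not occur for
  \<open>k \<le> DIM('a)\<close>.\<close>
definition codim_faces :: "nat \<Rightarrow> 'a::euclidean_space set \<Rightarrow> 'a set set" where
  "codim_faces k K = {F. F face_of K \<and> aff_dim F = int DIM('a) - int k}"

definition barycenter :: "'a::euclidean_space set \<Rightarrow> 'a" where
  "barycenter F = (\<Sum>x\<in>{x. x extreme_point_of F}. x) /\<^sub>R real (card {x. x extreme_point_of F})"

definition unit_normal :: "'a::euclidean_space set \<Rightarrow> 'a \<Rightarrow> bool" where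
  "unit_normal F n \<longleftrightarrow> norm n = 1 \<and> (\<forall>x\<in>F. \<forall>y\<in>F. n \<bullet> (x - y) = 0)"

text \<open>For a \<open>(d-1)\<close>-dimensional face \<open>F\<close> on the boundary of the convex domain
  \<open>\<Omega>\<close> there is exactly one such \<open>n\<close>.\<close>
definition outward_unit_normal :: "'a::euclidean_space set \<Rightarrow> 'a set \<Rightarrow> 'a \<Rightarrow> bool" where
  "outward_unit_normal \<Omega> F n \<longleftrightarrow>
     unit_normal F n \<and> (\<forall>x\<in>F. \<forall>y\<in>\<Omega>. n \<bullet> (y - x) \<le> 0)"

text \<open>The \<open>m\<close>-dimensional Lebesgue measure on the affine hull (of dimension \<open>m\<close>) of
  \<open>e\<close>: the image of the product measure under an isometric parametrisation by coordinates in
  an orthonormal basis of the direction space.  It does not depend on the chosen origin and basis.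
  For \<open>m = 0\<close> it is the Dirac measure.\<close>
definition surface_measure :: "'a::euclidean_space set \<Rightarrow> 'a measure" where
  "surface_measure e =
     (let a = (SOME a. a \<in> e);
          B = (SOME B. pairwise orthogonal B \<and> (\<forall>b\<in>B. norm b = 1) \<and>
                       span B = span ((\<lambda>x. x - a) ` e))
      in distr (\<Pi>\<^sub>M b\<in>B. lborel) borel (\<lambda>y. a + (\<Sum>b\<in>B. y b *\<^sub>R b)))"

definition surface_integral :: "'a::euclidean_space set \<Rightarrow> ('a \<Rightarrow> real) \<Rightarrow> real" where
  "surface_integral e g = (LINT x:e|surface_measure e. g x)"

definition integral_average :: "'a::euclidean_space set \<Rightarrow> ('a \<Rightarrow> real) \<Rightarrow> real" where
  "integral_average e g = surface_integral e g / measure (surface_measure e) e"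


section \<open>Sobolev spaces\<close>

text \<open>Elements of \<open>L\<^sup>2(U)\<close> are represented by functions on the whole space; only their
  values almost everywhere on \<open>U\<close> matter.\<close>
definition L2 :: "'a::euclidean_space set \<Rightarrow> ('a \<Rightarrow> 'b::euclidean_space) set" where
  "L2 U = {v. v \<in> borel_measurable (lebesgue_on U) \<and>
              integrable (lebesgue_on U) (\<lambda>x. (norm (v x))\<^sup>2)}"

definition l2_inner ::
    "'a::euclidean_space set \<Rightarrow> ('a \<Rightarrow> 'b::euclidean_space) \<Rightarrow> ('a \<Rightarrow> 'b) \<Rightarrow> real" where
  "l2_inner U v w = (LINT x|lebesgue_on U. v x \<bullet> w x)"

primrec C_k :: "nat \<Rightarrow> ('a::euclidean_space \<Rightarrow> real) \<Rightarrow> bool" where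
  "C_k 0 g \<longleftrightarrow> continuous_on UNIV g"
| "C_k (Suc k) g \<longleftrightarrow> (\<forall>x. g differentiable (at x)) \<and>
     (\<forall>b\<in>Basis. C_k k (\<lambda>x. frechet_derivative g (at x) b))"

definition test_functions :: "'a::euclidean_space set \<Rightarrow> ('a \<Rightarrow> real) set" where
  "test_functions U =
     {\<phi>. (\<forall>k. C_k k \<phi>) \<and> compact (closure {x. \<phi> x \<noteq> 0}) \<and> closure {x. \<phi> x \<noteq> 0} \<subseteq> U}"

definition has_weak_gradient ::
    "'a::euclidean_space set \<Rightarrow> ('a \<Rightarrow> real) \<Rightarrow> ('a \<Rightarrow> 'a) \<Rightarrow> bool" where
  "has_weak_gradient U v G \<longleftrightarrow>
     (\<forall>\<phi>\<in>test_functions U. \<forall>b\<in>Basis.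
        (LINT x|lebesgue_on U. v x * frechet_derivative \<phi> (at x) b)
          = - (LINT x|lebesgue_on U. (G x \<bullet> b) * \<phi> x))"

definition H1 :: "'a::euclidean_space set \<Rightarrow> ('a \<Rightarrow> real) set" where
  "H1 U = {v \<in> L2 U. \<exists>G\<in>L2 U. has_weak_gradient U v G}"

text \<open>For \<open>v \<in> H1 U\<close>, a representative of the weak gradient, which is unique almost
  everywhere on \<open>U\<close>.\<close>
definition grad :: "'a::euclidean_space set \<Rightarrow> ('a \<Rightarrow> real) \<Rightarrow> 'a \<Rightarrow> 'a" where
  "grad U v = (SOME G. G \<in> L2 U \<and> has_weak_gradient U v G)"

definition h1_norm :: "'a::euclidean_space set \<Rightarrow> ('a \<Rightarrow> real) \<Rightarrow> real" where
  "h1_norm U v = sqrt (l2_inner U v v + l2_inner U (grad U v) (grad U v))"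

text \<open>The closure of the test functions in \<open>H\<^sup>1(U)\<close>.\<close>
definition H1_0 :: "'a::euclidean_space set \<Rightarrow> ('a \<Rightarrow> real) set" where
  "H1_0 U = {v \<in> H1 U. \<exists>\<phi>. (\<forall>k::nat. \<phi> k \<in> test_functions U) \<and>
                        (\<lambda>k. h1_norm U (\<lambda>x. v x - \<phi> k x)) \<longlonglongrightarrow> 0}"


section \<open>Piecewise functions\<close>

definition polynomial_fun :: "nat \<Rightarrow> ('a::euclidean_space \<Rightarrow> real) \<Rightarrow> bool" where
  "polynomial_fun k p \<longleftrightarrow>
     (\<exists>c. \<forall>x. p x = (\<Sum>\<alpha> \<in> {\<alpha> \<in> Basis \<rightarrow>\<^sub>E UNIV. (\<Sum>b\<in>Basis. \<alpha> b) \<le> k}.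
                       c \<alpha> * (\<Prod>b\<in>Basis. (x \<bullet> b) ^ \<alpha> b)))"

text \<open>A piecewise function is represented by a single function whose values on the mesh skeleton,
  a null set, are irrelevant; its restriction to an element is determined by its values in the
  interior of that element.\<close>
definition piecewise_polynomial ::
    "'a::euclidean_space set set \<Rightarrow> nat \<Rightarrow> ('a \<Rightarrow> real) \<Rightarrow> bool" where
  "piecewise_polynomial \<T> k v \<longleftrightarrow>
     (\<forall>K\<in>\<T>. \<exists>p. polynomial_fun k p \<and> (\<forall>x\<in>interior K. v x = p x))"

definition grad_h :: "'a::euclidean_space set set \<Rightarrow> ('a \<Rightarrow> real) \<Rightarrow> 'a \<Rightarrow> 'a" where
  "grad_h \<T> v x = (\<Sum>K\<in>\<T>. indicator (interior K) x *\<^sub>R grad (interior K) v x)"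

text \<open>The entry of the elementwise Hessian for the coordinate directions \<open>b\<close> and
  \<open>c\<close>.\<close>
definition hessian_h ::
    "'a::euclidean_space set set \<Rightarrow> ('a \<Rightarrow> real) \<Rightarrow> 'a \<Rightarrow> 'a \<Rightarrow> 'a \<Rightarrow> real" where
  "hessian_h \<T> v b c x = grad_h \<T> (\<lambda>y. grad_h \<T> v y \<bullet> b) x \<bullet> c"

text \<open>Traces from the element \<open>K\<close>, as limits from the interior of \<open>K\<close>.\<close>
definition elem_trace :: "'a::euclidean_space set \<Rightarrow> ('a \<Rightarrow> real) \<Rightarrow> 'a \<Rightarrow> real" where
  "elem_trace K v x = Lim (at x within interior K) v"

definition normal_derivative ::
    "'a::euclidean_space set \<Rightarrow> 'a \<Rightarrow> ('a \<Rightarrow> real) \<Rightarrow> 'a \<Rightarrow> real" where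
  "normal_derivative K n v = elem_trace K (\<lambda>y. frechet_derivative v (at y) n)"


section \<open>Finite element spaces and forms\<close>

text \<open>The global MWX space without boundary conditions.  An \<open>F\<close> shared by no two elements
  imposes no condition, and the condition on \<open>F\<close> does not depend on the sign of
  \<open>n\<close>.\<close>
definition MWX_space :: "'a::euclidean_space set set \<Rightarrow> ('a \<Rightarrow> real) set" where
  "MWX_space \<T> = {v. piecewise_polynomial \<T> 2 v \<and>
     (\<forall>K\<in>\<T>. \<forall>K'\<in>\<T>. \<forall>e \<in> codim_faces 2 K \<inter> codim_faces 2 K'.
        integral_average e (elem_trace K v) = integral_average e (elem_trace K' v)) \<and>
     (\<forall>K\<in>\<T>. \<forall>K'\<in>\<T>. \<forall>F \<in> codim_faces 1 K \<inter> codim_faces 1 K'. \<forall>n. unit_normal F n \<longrightarrow>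
        normal_derivative K n v (barycenter F) = normal_derivative K' n v (barycenter F))}"

definition V_h :: "'a::euclidean_space set \<Rightarrow> 'a set set \<Rightarrow> ('a \<Rightarrow> real) set" where
  "V_h \<Omega> \<T> = {v \<in> MWX_space \<T>. \<forall>K\<in>\<T>. \<forall>e \<in> codim_faces 2 K. e \<subseteq> frontier \<Omega> \<longrightarrow>
     surface_integral e (elem_trace K v) = 0}"

definition V_h0 :: "'a::euclidean_space set \<Rightarrow> 'a set set \<Rightarrow> ('a \<Rightarrow> real) set" where
  "V_h0 \<Omega> \<T> = {v \<in> V_h \<Omega> \<T>. \<forall>K\<in>\<T>. \<forall>F \<in> codim_faces 1 K. F \<subseteq> frontier \<Omega> \<longrightarrow>
     (\<forall>n. outward_unit_normal \<Omega> F n \<longrightarrow> surface_integral F (normal_derivative K n v) = 0)}"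

definition W_h :: "'a::euclidean_space set \<Rightarrow> 'a set set \<Rightarrow> nat \<Rightarrow> ('a \<Rightarrow> real) set" where
  "W_h \<Omega> \<T> l = {v \<in> H1_0 \<Omega>. piecewise_polynomial \<T> l v}"

definition a_h ::
    "'a::euclidean_space set \<Rightarrow> 'a set set \<Rightarrow> ('a \<Rightarrow> real) \<Rightarrow> ('a \<Rightarrow> real) \<Rightarrow> real" where
  "a_h \<Omega> \<T> w v =
     (\<Sum>b\<in>Basis. \<Sum>c\<in>Basis. l2_inner \<Omega> (hessian_h \<T> w b c) (hessian_h \<T> v b c))"

definition b_h ::
    "'a::euclidean_space set \<Rightarrow> 'a set set \<Rightarrow> ('a \<Rightarrow> real) \<Rightarrow> ('a \<Rightarrow> real) \<Rightarrow> real" where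
  "b_h \<Omega> \<T> w v = l2_inner \<Omega> (grad_h \<T> w) (grad_h \<T> v)"

text \<open>Meaningful for piecewise \<open>H\<^sup>1\<close> functions, that is, \<open>v \<in> H1 (interior K)\<close> for all
  \<open>K \<in> \<T>\<close>; for these it is determined uniquely almost everywhere on \<open>\<Omega>\<close>.\<close>
definition P_h ::
    "'a::euclidean_space set \<Rightarrow> 'a set set \<Rightarrow> nat \<Rightarrow> ('a \<Rightarrow> real) \<Rightarrow> 'a \<Rightarrow> real" where
  "P_h \<Omega> \<T> l v = (SOME p. p \<in> W_h \<Omega> \<T> l \<and>
     (\<forall>\<eta>\<in>W_h \<Omega> \<T> l.
        l2_inner \<Omega> (grad \<Omega> p) (grad \<Omega> \<eta>) = l2_inner \<Omega> (grad_h \<T> v) (grad \<Omega> \<eta>)))"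


section \<open>The discrete problems\<close>

definition MWX_solution ::
    "'a::euclidean_space set \<Rightarrow> 'a set set \<Rightarrow> nat \<Rightarrow> real \<Rightarrow> ('a \<Rightarrow> real) \<Rightarrow> ('a \<Rightarrow> real) \<Rightarrow> bool"
  where
  "MWX_solution \<Omega> \<T> l \<epsilon> f u \<longleftrightarrow> u \<in> V_h0 \<Omega> \<T> \<and>
     (\<forall>v\<in>V_h0 \<Omega> \<T>. \<epsilon>\<^sup>2 * a_h \<Omega> \<T> u v + b_h \<Omega> \<T> u v = l2_inner \<Omega> f (P_h \<Omega> \<T> l v))"

definition decoupled_solution ::
    "'a::euclidean_space set \<Rightarrow> 'a set set \<Rightarrow> nat \<Rightarrow> real \<Rightarrow> ('a \<Rightarrow> real) \<Rightarrow>
      ('a \<Rightarrow> real) \<Rightarrow> ('a \<Rightarrow> real) \<Rightarrow> bool"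
  where
  "decoupled_solution \<Omega> \<T> l \<epsilon> f w u \<longleftrightarrow> w \<in> W_h \<Omega> \<T> l \<and> u \<in> V_h0 \<Omega> \<T> \<and>
     (\<forall>\<eta>\<in>W_h \<Omega> \<T> l. l2_inner \<Omega> (grad \<Omega> w) (grad \<Omega> \<eta>) = l2_inner \<Omega> f \<eta>) \<and>
     (\<forall>v\<in>V_h0 \<Omega> \<T>. \<epsilon>\<^sup>2 * a_h \<Omega> \<T> u v + b_h \<Omega> \<T> u v
                        = l2_inner \<Omega> (grad \<Omega> w) (grad_h \<T> v))"

end

theory Submission
  imports Defs
begin

text \<open>Let \<open>w\<^sub>h\<close> solve \<open>(\<nabla>w\<^sub>h, \<nabla>\<chi>) = (f, \<chi>)\<close> on \<open>W\<^sub>h\<close>.  Testing with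
  \<open>\<chi> = P\<^sub>h v\<close>, and then the definition of \<open>P\<^sub>h\<close> with \<open>w\<^sub>h\<close>, gives
  \<open>(f, P\<^sub>h v) = (\<nabla>w\<^sub>h, \<nabla>P\<^sub>h v) = (\<nabla>w\<^sub>h, \<nabla>\<^sub>h v)\<close>, so the two discrete problems have the same
  right-hand side.  What remains is that \<open>w\<^sub>h\<close> and \<open>P\<^sub>h v\<close> exist.  Both are Riesz
  representations on the finite-dimensional space \<open>W\<^sub>h\<close>, whose form is definite modulo null
  functions by the Poincare inequality; it is linear in the chosen weak gradients because these are
  unique almost everywhere (density of the test functions).\<close>

section \<open>Smooth functions and test functions\<close>

text \<open>Functions of a mesh space carry arbitrary values on the skeleton and outside \<Omega>,
  so \<open>W_h\<close> is not finite-dimensional as a set of functions, and \<open>grad\<close>,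
  \<open>grad_h\<close> and \<open>P_h\<close> are choices that say nothing until a suitable object
  is known to exist. Quotients by null functions are avoided: each functional to be represented is
  shown to vanish on functions that are zero almost everywhere, and finite dimension is expressed
  through finitely many moments, the integrals of a function against monomials on each element.
  Moments are linear by construction, whereas coefficients would have to be read off from a chosen
  polynomial. The longest detour is uniqueness of the weak gradient. Test functions are smooth of
  every order and have compact support, so nonzero ones have to be built from a flat exponential,
  and enough of them are needed to recover the indicator of every open set as a bounded
  limit.\<close>

lemma C_k_SucI:
  assumes "\<And>x. (g has_derivative D x) (at x)" and "\<And>b. b \<in> Basis \<Longrightarrow> C_k k (\<lambda>x. D x b)"
  shows "C_k (Suc k) g"
proof -
  have "frechet_derivative g (at x) = D x" for x
    using frechet_derivative_at[OF assms(1)] by metis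
  moreover have "g differentiable (at x)" for x
    using assms(1) by (auto simp: differentiable_def)
  ultimately show ?thesis using assms(2) by simp
qed

lemma C_k_Suc_has_derivative:
  assumes "C_k (Suc k) g"
  shows "(g has_derivative frechet_derivative g (at x)) (at x)"
  using assms frechet_derivative_works by auto

lemma C_k_Suc_imp: "C_k (Suc k) g \<Longrightarrow> C_k k g"
proof (induction k arbitrary: g)
  case 0
  then show ?case
    by (auto intro!: differentiable_imp_continuous_on simp: differentiable_on_def
        intro: differentiable_at_withinI)
next
  case (Suc k)
  then show ?case by (metis C_k.simps(2))
qed

lemma C_k_const: "C_k k (\<lambda>x. c)"
proof (induction k arbitrary: c)
  case (Suc k)
  show ?case by (rule C_k_SucI[of _ "\<lambda>_ _. 0"]) (auto intro: Suc)
qed simp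

lemma C_k_inner: "C_k k (\<lambda>x. x \<bullet> a)"
proof (cases k)
  case 0
  then show ?thesis by (simp add: continuous_intros)
next
  case (Suc m)
  show ?thesis unfolding Suc
    by (rule C_k_SucI[of _ "\<lambda>_ y. y \<bullet> a"]) (auto intro!: derivative_eq_intros C_k_const)
qed

lemma C_k_add: "C_k k f \<Longrightarrow> C_k k g \<Longrightarrow> C_k k (\<lambda>x. f x + g x)"
proof (induction k arbitrary: f g)
  case 0
  then show ?case by (simp add: continuous_on_add)
next
  case (Suc k)
  show ?case
    by (rule C_k_SucI[OF has_derivative_add[OF Suc.prems[THEN C_k_Suc_has_derivative]]])
       (use Suc in auto)
qed

lemma C_k_mult: "C_k k f \<Longrightarrow> C_k k g \<Longrightarrow> C_k k (\<lambda>x. f x * g x)"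
proof (induction k arbitrary: f g)
  case 0
  then show ?case by (simp add: continuous_on_mult)
next
  case (Suc k)
  show ?case
    by (rule C_k_SucI[OF has_derivative_mult[OF Suc.prems[THEN C_k_Suc_has_derivative]]])
       (use Suc Suc.prems[THEN C_k_Suc_imp] in \<open>auto intro!: C_k_add\<close>)
qed

lemma C_k_sum: "(\<And>i. i \<in> I \<Longrightarrow> C_k k (f i)) \<Longrightarrow> C_k k (\<lambda>x. \<Sum>i\<in>I. f i x)"
  by (induction I rule: infinite_finite_induct) (auto intro: C_k_const C_k_add)

lemma C_k_prod: "(\<And>i. i \<in> I \<Longrightarrow> C_k k (f i)) \<Longrightarrow> C_k k (\<lambda>x. \<Prod>i\<in>I. f i x)"
  by (induction I rule: infinite_finite_induct) (auto intro: C_k_const C_k_mult)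

lemma C_k_power: "C_k k f \<Longrightarrow> C_k k (\<lambda>x. f x ^ n)"
  by (induction n) (auto intro: C_k_const C_k_mult)

text \<open>The outer function enters together with all its derivatives: the chain rule turns
  \<open>h n\<close> into \<open>h (Suc n)\<close>, so the induction on \<open>k\<close> has to
  cover every \<open>n\<close> at once.\<close>

lemma C_k_compose:
  fixes h :: "nat \<Rightarrow> real \<Rightarrow> real"
  assumes h: "\<And>n t. (h n has_real_derivative h (Suc n) t) (at t)"
  shows "C_k k g \<Longrightarrow> C_k k (\<lambda>x. h n (g x))"
proof (induction k arbitrary: n)
  case 0
  have "continuous_on UNIV (h n)"
    using DERIV_isCont[OF h] by (simp add: continuous_at_imp_continuous_on)
  with 0 show ?case
    using continuous_on_compose2[of UNIV "h n" UNIV g] by simp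
next
  case (Suc k)
  have "((\<lambda>x. h n (g x)) has_derivative (\<lambda>y. frechet_derivative g (at x) y * h (Suc n) (g x))) (at x)" for x
    using has_derivative_compose[OF C_k_Suc_has_derivative[OF Suc.prems] h[unfolded has_field_derivative_def]]
    by (simp add: mult.commute)
  then show ?case
    by (rule C_k_SucI) (use Suc.IH C_k_Suc_imp[OF Suc.prems] Suc.prems in \<open>auto intro!: C_k_mult\<close>)
qed

lemma polynomial_fun_C_k:
  assumes "polynomial_fun l p"
  shows "C_k k p"
proof -
  obtain c where "p = (\<lambda>x. (\<Sum>\<alpha> \<in> {\<alpha> \<in> Basis \<rightarrow>\<^sub>E UNIV. (\<Sum>b\<in>Basis. \<alpha> b) \<le> l}.
                       c \<alpha> * (\<Prod>b\<in>Basis. (x \<bullet> b) ^ \<alpha> b)))"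
    using assms unfolding polynomial_fun_def by blast
  then show ?thesis
    by (auto intro!: C_k_sum C_k_mult C_k_const C_k_prod C_k_power C_k_inner)
qed

text \<open>For \<open>p = 1\<close> this is the classical smooth function that is flat at 0. The
  polynomial factor makes the family closed under differentiation: with s = 1/t, the derivative of
  p(s) exp(-s) in t is s^2 (p(s) - p'(s)) exp(-s), and \<open>[:0, 0, 1:]\<close> is s^2.\<close>

definition flat_exp :: "real poly \<Rightarrow> real \<Rightarrow> real" where
  "flat_exp p t = (if t > 0 then poly p (1 / t) * exp (- (1 / t)) else 0)"

lemma tendsto_poly_mult_exp_minus: "((\<lambda>s. poly p s * exp (- s)) \<longlongrightarrow> (0::real)) at_top"
proof -
  have "((\<lambda>s. \<Sum>i\<le>degree p. coeff p i * (s ^ i / exp s)) \<longlongrightarrow> (\<Sum>i\<le>degree p. coeff p i * 0)) at_top"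
    by (intro tendsto_sum tendsto_mult tendsto_const tendsto_power_div_exp_0)
  moreover have "(\<Sum>i\<le>degree p. coeff p i * (s ^ i / exp s)) = poly p s * exp (- s)" for s
    by (simp add: poly_altdef sum_distrib_right exp_minus divide_inverse mult.assoc)
  ultimately show ?thesis by simp
qed

lemma flat_exp_has_derivative:
  "(flat_exp p has_real_derivative flat_exp ([:0, 0, 1:] * (p - pderiv p)) t) (at t)"
proof -
  consider "t > 0" | "t < 0" | "t = 0" by linarith
  then show ?thesis
  proof cases
    case 1
    have "((\<lambda>t. poly p (1 / t) * exp (- (1 / t))) has_real_derivative
            flat_exp ([:0, 0, 1:] * (p - pderiv p)) t) (at t)"
      using 1 by (auto intro!: derivative_eq_intros poly_DERIV[THEN DERIV_chain2]
          simp: flat_exp_def power2_eq_square field_simps)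
    then show ?thesis
      by (rule has_field_derivative_transform_within_open[where S="{0<..}"])
         (use 1 in \<open>auto simp: flat_exp_def\<close>)
  next
    case 2
    have "((\<lambda>t. 0) has_real_derivative flat_exp ([:0, 0, 1:] * (p - pderiv p)) t) (at t)"
      using 2 by (auto simp: flat_exp_def)
    then show ?thesis
      by (rule has_field_derivative_transform_within_open[where S="{..<0}"])
         (use 2 in \<open>auto simp: flat_exp_def\<close>)
  next
    case 3
    \<comment> \<open>This is the difference quotient at 0 from the right: dividing by t multiplies
      by s = 1/t, hence the factor \<open>[:0, 1:]\<close>.\<close>
    have "((\<lambda>t. poly ([:0, 1:] * p) (inverse t) * exp (- inverse t)) \<longlongrightarrow> 0) (at_right (0::real))"
      using tendsto_poly_mult_exp_minus filterlim_inverse_at_top_right by (rule filterlim_compose)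
    then have "((\<lambda>t. flat_exp p t / t) \<longlongrightarrow> 0) (at_right 0)"
      by (rule Lim_transform_eventually)
         (auto simp: eventually_at_filter flat_exp_def field_simps intro!: always_eventually)
    moreover have "((\<lambda>t. flat_exp p t / t) \<longlongrightarrow> 0) (at_left 0)"
      by (rule Lim_transform_eventually[OF tendsto_const])
         (auto simp: eventually_at_filter flat_exp_def intro!: always_eventually)
    ultimately show ?thesis
      unfolding 3 has_field_derivative_iff by (auto simp: flat_exp_def intro: filterlim_split_at)
  qed
qed

lemma C_k_flat_exp: "C_k k g \<Longrightarrow> C_k k (\<lambda>x. flat_exp p (g x))"
  using C_k_compose[of "\<lambda>n. flat_exp (((\<lambda>p. [:0, 0, 1:] * (p - pderiv p)) ^^ n) p)" k g 0]
    flat_exp_has_derivative by simp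

text \<open>The saturation 1 - exp(-t) keeps 0 at 0 and sends large values close to 1; it turns
  growing sums of bumps into bounded approximations of an indicator.\<close>

lemma C_k_one_minus_exp:
  assumes "C_k k g"
  shows "C_k k (\<lambda>x. 1 - exp (- (c * g x)))"
proof -
  \<comment> \<open>The derivatives of -exp(-t) only alternate in sign. The summand 1 would break
    this pattern and is added at the end.\<close>
  have "((\<lambda>t. - exp (- t) * (- 1) ^ n) has_real_derivative - exp (- t) * (- 1) ^ Suc n) (at t)" for n t
    by (auto intro!: derivative_eq_intros)
  from C_k_compose[of "\<lambda>n t. - exp (- t) * (- 1) ^ n", OF this, of k "\<lambda>x. c * g x" 0]
    C_k_mult[OF C_k_const assms, of c]
  have "C_k k (\<lambda>x. - exp (- (c * g x)))"
    by simp
  from C_k_add[OF C_k_const this, of 1] show ?thesis by simp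
qed

section \<open>Test functions and the approximation of indicators of open sets\<close>

lemma test_functionsI:
  assumes "\<And>k. C_k k \<phi>" "compact S" "S \<subseteq> U" "\<And>x. x \<notin> S \<Longrightarrow> \<phi> x = 0"
  shows "\<phi> \<in> test_functions U"
proof -
  have *: "closure {x. \<phi> x \<noteq> 0} \<subseteq> S"
    using assms(2,4) by (intro closure_minimal) (auto intro: compact_imp_closed)
  then have "compact (closure {x. \<phi> x \<noteq> 0})"
    using compact_closure bounded_subset compact_imp_bounded assms(2) closure_subset by (metis subset_trans)
  with * assms show ?thesis by (auto simp: test_functions_def)
qed

lemma test_functionsD:
  assumes "\<phi> \<in> test_functions U"
  obtains S where "\<And>k. C_k k \<phi>" "compact S" "S \<subseteq> U" "\<And>x. x \<notin> S \<Longrightarrow> \<phi> x = 0"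
  by (rule that[of "closure {x. \<phi> x \<noteq> 0}"])
     (use assms closure_subset[of "{x. \<phi> x \<noteq> 0}"] in \<open>auto simp: test_functions_def\<close>)

lemma test_functions_add_scale:
  assumes "\<phi> \<in> test_functions U" "\<psi> \<in> test_functions U"
  shows "(\<lambda>x. \<phi> x + c * \<psi> x) \<in> test_functions U"
proof -
  obtain S where S: "\<And>k. C_k k \<phi>" "compact S" "S \<subseteq> U" "\<And>x. x \<notin> S \<Longrightarrow> \<phi> x = 0"
    using assms(1) test_functionsD by blast
  obtain T where T: "\<And>k. C_k k \<psi>" "compact T" "T \<subseteq> U" "\<And>x. x \<notin> T \<Longrightarrow> \<psi> x = 0"
    using assms(2) test_functionsD by blast
  show ?thesis
    by (rule test_functionsI[of _ "S \<union> T"])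
       (use S T in \<open>auto intro!: C_k_add C_k_mult C_k_const\<close>)
qed

lemma zero_test_function: "(\<lambda>x. 0) \<in> test_functions U"
  by (rule test_functionsI[of _ "{}"]) (auto intro: C_k_const)

lemma bump_test_function:
  assumes "cball a r \<subseteq> U" "r > 0"
  obtains \<phi> where "\<phi> \<in> test_functions U" "\<And>x. 0 \<le> \<phi> x" "\<And>x. x \<in> ball a r \<Longrightarrow> 0 < \<phi> x"
proof
  \<comment> \<open>The function r^2 - |x - a|^2 is positive exactly on the open ball. It is spelled
    out with sums and products of coordinates so that the closure rules for \<open>C_k\<close>
    apply.\<close>
  let ?g = "\<lambda>x. r\<^sup>2 + (-1) * (\<Sum>b\<in>Basis. (x \<bullet> b + (- (a \<bullet> b))) ^ 2)"
  have g: "?g x = r\<^sup>2 - (dist a x)\<^sup>2" for x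
    by (simp add: euclidean_dist_l2[of a] L2_set_def dist_real_def sum_nonneg power2_commute)
  have pos: "?g x > 0 \<longleftrightarrow> dist a x < r" for x
    unfolding g using assms(2) power_mono_iff[of r "dist a x" 2]
    by (metis diff_gt_0_iff_gt less_imp_le linorder_not_less zero_le_dist zero_less_numeral)
  show "(\<lambda>x. flat_exp 1 (?g x)) \<in> test_functions U"
  proof (rule test_functionsI[of _ "cball a r"])
    show "C_k k (\<lambda>x. flat_exp 1 (?g x))" for k
      by (intro C_k_flat_exp C_k_add C_k_const C_k_mult C_k_sum C_k_power C_k_inner)
    show "flat_exp 1 (?g x) = 0" if "x \<notin> cball a r" for x
      using that pos[of x] by (auto simp: flat_exp_def)
  qed (use assms in auto)
  show "0 \<le> flat_exp 1 (?g x)" for x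
    by (simp add: flat_exp_def)
  show "0 < flat_exp 1 (?g x)" if "x \<in> ball a r" for x
    using that pos[of x] by (auto simp: flat_exp_def)
qed

text \<open>Countably many balls cover \<open>V\<close>, each with a bump that is positive on it. A
  finite partial sum of bumps is again a test function, and
  \<open>1 - exp (- (real n * \<psi> n x))\<close> keeps its support while pushing positive values
  towards 1; the series of bumps itself never has to converge.\<close>

lemma indicator_open_limit_test_functions:
  fixes V :: "'a::euclidean_space set"
  assumes "open V"
  obtains \<phi> where "\<And>n::nat. \<phi> n \<in> test_functions V" "\<And>n x. \<bar>\<phi> n x\<bar> \<le> 1"
    "\<And>x. (\<lambda>n. \<phi> n x) \<longlonglongrightarrow> indicator V x"
proof -
  \<comment> \<open>The closed ball has to lie in \<open>V\<close>, because it serves as the compact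
    set outside which the bump vanishes.\<close>
  define \<B> where "\<B> = {ball a r | a r. r > 0 \<and> cball a r \<subseteq> V}"
  obtain \<F> where \<F>: "\<F> \<subseteq> \<B>" "countable \<F>" "\<Union>\<F> = \<Union>\<B>"
    by (rule Lindelof[of \<B>]) (auto simp: \<B>_def)
  have UB: "\<Union>\<B> = V"
  proof
    show "V \<subseteq> \<Union>\<B>"
    proof
      fix x assume "x \<in> V"
      then obtain r where "r > 0" "cball x r \<subseteq> V"
        using assms open_contains_cball by blast
      then show "x \<in> \<Union>\<B>" by (auto simp: \<B>_def intro!: exI[of _ "ball x r"])
    qed
    show "\<Union>\<B> \<subseteq> V" using ball_subset_cball by (fastforce simp: \<B>_def)
  qed
  have "\<forall>B\<in>\<B>. \<exists>\<phi>. \<phi> \<in> test_functions V \<and> (\<forall>x. 0 \<le> \<phi> x) \<and> (\<forall>x\<in>B. 0 < \<phi> x)"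
    unfolding \<B>_def using bump_test_function by (smt (verit) mem_Collect_eq)
  then obtain \<beta> where \<beta>: "\<And>B. B \<in> \<B> \<Longrightarrow> \<beta> B \<in> test_functions V"
      "\<And>B x. B \<in> \<B> \<Longrightarrow> 0 \<le> \<beta> B x" "\<And>B x. B \<in> \<B> \<Longrightarrow> x \<in> B \<Longrightarrow> 0 < \<beta> B x"
    by metis
  show ?thesis
  proof (cases "\<F> = {}")
    case True
    then have "V = {}" using \<F> UB by auto
    then show ?thesis using that[of "\<lambda>_ _. 0"] zero_test_function by auto
  next
    case False
    define B where "B = from_nat_into \<F>"
    have B: "B i \<in> \<B>" for i using \<F>(1) False by (auto simp: B_def from_nat_into subset_iff)
    have B_V: "\<exists>i. x \<in> B i" if "x \<in> V" for x
      using that \<F>(2,3) UB False by (metis B_def UnionE from_nat_into_surj)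
    define \<psi> where "\<psi> n x = (\<Sum>i<n. \<beta> (B i) x)" for n :: nat and x
    have \<psi>_test: "\<psi> n \<in> test_functions V" for n
    proof (induction n)
      case 0
      then show ?case using zero_test_function by (simp add: \<psi>_def[abs_def])
    next
      case (Suc n)
      from test_functions_add_scale[OF Suc \<beta>(1)[OF B[of n]], of 1] show ?case
        by (simp add: \<psi>_def[abs_def])
    qed
    have \<psi>_nonneg: "0 \<le> \<psi> n x" for n x
      using \<beta>(2) B by (auto simp: \<psi>_def intro: sum_nonneg)
    \<comment> \<open>At a point of \<open>V\<close> the partial sums stay above one fixed positive
      bump value from some index on, so the factor \<open>real n\<close> drives the exponent to
      infinity. Outside \<open>V\<close> all partial sums vanish.\<close>
    have lim: "(\<lambda>n. 1 - exp (- (real n * \<psi> n x))) \<longlonglongrightarrow> indicator V x" for x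
    proof (cases "x \<in> V")
      case True
      then obtain i where i: "x \<in> B i" using B_V by blast
      then have pos: "0 < \<beta> (B i) x" using \<beta>(3) B by blast
      have le: "\<beta> (B i) x \<le> \<psi> n x" if "n > i" for n
        unfolding \<psi>_def using \<beta>(2) B that by (intro member_le_sum) auto
      have "\<forall>\<^sub>F n in sequentially. \<beta> (B i) x * real n \<le> real n * \<psi> n x"
        using eventually_gt_at_top[of i]
        by eventually_elim (metis le mult.commute mult_left_mono of_nat_0_le_iff)
      moreover have "filterlim (\<lambda>n. \<beta> (B i) x * real n) at_top sequentially"
        by (rule filterlim_tendsto_pos_mult_at_top[OF tendsto_const pos filterlim_real_sequentially])
      ultimately have "filterlim (\<lambda>n. real n * \<psi> n x) at_top sequentially"
        by (rule filterlim_at_top_mono[rotated])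
      then have "(\<lambda>n. exp (- (real n * \<psi> n x))) \<longlonglongrightarrow> 0"
        by (intro filterlim_compose[OF exp_at_bot]) (simp add: filterlim_uminus_at_top)
      from tendsto_diff[OF tendsto_const this, of 1] True show ?thesis by simp
    next
      case False
      have "\<psi> n x = 0" for n
        using \<psi>_test[of n] False test_functionsD by (metis subsetD)
      with False show ?thesis by simp
    qed
    show ?thesis
    proof (rule that)
      show "(\<lambda>x. 1 - exp (- (real n * \<psi> n x))) \<in> test_functions V" for n
      proof -
        obtain S where S: "\<And>k. C_k k (\<psi> n)" "compact S" "S \<subseteq> V" "\<And>x. x \<notin> S \<Longrightarrow> \<psi> n x = 0"
          using \<psi>_test test_functionsD by blast
        show ?thesis
          by (rule test_functionsI[of _ S]) (use S in \<open>auto intro: C_k_one_minus_exp\<close>)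
      qed
      show "\<bar>1 - exp (- (real n * \<psi> n x))\<bar> \<le> 1" for n x
      proof -
        have "exp (- (real n * \<psi> n x)) \<le> 1" "0 < exp (- (real n * \<psi> n x))"
          using \<psi>_nonneg[of n x] by simp_all
        then show ?thesis by linarith
      qed
    qed (rule lim)
  qed
qed

section \<open>Square integrable functions\<close>

lemma continuous_measurable_lebesgue_on:
  fixes f :: "'a::euclidean_space \<Rightarrow> 'b::euclidean_space"
  assumes "continuous_on UNIV f"
  shows "f \<in> borel_measurable (lebesgue_on U)"
  using borel_measurable_continuous_onI[OF assms]
  by (intro measurable_restrict_space1 measurable_completion) simp

lemma L2_add_scaleR:
  fixes v w :: "'a::euclidean_space \<Rightarrow> 'b::euclidean_space"
  assumes "v \<in> L2 U" "w \<in> L2 U"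
  shows "(\<lambda>x. v x + c *\<^sub>R w x) \<in> L2 U"
proof -
  have [measurable]: "v \<in> borel_measurable (lebesgue_on U)" "w \<in> borel_measurable (lebesgue_on U)"
    using assms by (auto simp: L2_def)
  have bound: "(norm (x + c *\<^sub>R y))\<^sup>2 \<le> 2 * (norm x)\<^sup>2 + 2 * c\<^sup>2 * (norm y)\<^sup>2" for x y :: 'b
  proof -
    have "(norm (x + c *\<^sub>R y))\<^sup>2 \<le> (norm x + \<bar>c\<bar> * norm y)\<^sup>2"
      using norm_triangle_ineq[of x "c *\<^sub>R y"] by (intro power_mono) auto
    also have "\<dots> \<le> 2 * (norm x)\<^sup>2 + 2 * (\<bar>c\<bar> * norm y)\<^sup>2"
      using zero_le_power2[of "norm x - \<bar>c\<bar> * norm y"] by (simp add: power2_sum power2_diff)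
    finally show ?thesis by (simp add: power_mult_distrib)
  qed
  have "integrable (lebesgue_on U) (\<lambda>x. 2 * (norm (v x))\<^sup>2 + 2 * c\<^sup>2 * (norm (w x))\<^sup>2)"
    using assms by (auto simp: L2_def)
  then have "integrable (lebesgue_on U) (\<lambda>x. (norm (v x + c *\<^sub>R w x))\<^sup>2)"
    by (rule Bochner_Integration.integrable_bound) (use bound in \<open>auto intro!: AE_I2\<close>)
  then show ?thesis by (simp add: L2_def)
qed

lemma L2_inner_integrable:
  fixes v w :: "'a::euclidean_space \<Rightarrow> 'b::euclidean_space"
  assumes "v \<in> L2 U" "w \<in> L2 U"
  shows "integrable (lebesgue_on U) (\<lambda>x. v x \<bullet> w x)"
proof -
  have [measurable]: "v \<in> borel_measurable (lebesgue_on U)" "w \<in> borel_measurable (lebesgue_on U)"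
    using assms by (auto simp: L2_def)
  have bound: "\<bar>x \<bullet> y\<bar> \<le> (norm x)\<^sup>2 + (norm y)\<^sup>2" for x y :: 'b
  proof -
    have "\<bar>x \<bullet> y\<bar> \<le> norm x * norm y" by (rule Cauchy_Schwarz_ineq2)
    also have "\<dots> \<le> (norm x)\<^sup>2 + (norm y)\<^sup>2"
      using zero_le_power2[of "norm x - norm y"] zero_le_power2[of "norm x + norm y"]
      unfolding power2_sum power2_diff by linarith
    finally show ?thesis .
  qed
  have "integrable (lebesgue_on U) (\<lambda>x. (norm (v x))\<^sup>2 + (norm (w x))\<^sup>2)"
    using assms by (auto simp: L2_def)
  then show ?thesis
    by (rule Bochner_Integration.integrable_bound) (use bound in \<open>auto intro!: AE_I2\<close>)
qed

lemma continuous_L2: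
  fixes f :: "'a::euclidean_space \<Rightarrow> 'b::euclidean_space"
  assumes "continuous_on UNIV f" "U \<in> lmeasurable" "bounded U"
  shows "f \<in> L2 U"
proof -
  have [measurable]: "f \<in> borel_measurable (lebesgue_on U)"
    by (rule continuous_measurable_lebesgue_on[OF assms(1)])
  have "compact (f ` closure U)"
    using assms(1,3) by (intro compact_continuous_image) (auto intro: continuous_on_subset)
  then obtain M where M: "\<And>x. x \<in> closure U \<Longrightarrow> norm (f x) \<le> M"
    using compact_imp_bounded bounded_iff by (metis imageI)
  have "integrable (lebesgue_on U) (\<lambda>x. M\<^sup>2)"
    using assms(2) by (simp add: finite_measure.integrable_const finite_measure_lebesgue_on)
  then have "integrable (lebesgue_on U) (\<lambda>x. (norm (f x))\<^sup>2)"
  proof (rule Bochner_Integration.integrable_bound)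
    show "AE x in lebesgue_on U. norm ((norm (f x))\<^sup>2) \<le> norm (M\<^sup>2)"
      using M closure_subset[of U] by (intro AE_I2) (auto intro!: power_mono)
  qed simp
  then show ?thesis by (simp add: L2_def)
qed

lemma L2_imp_integrable:
  fixes f :: "'a::euclidean_space \<Rightarrow> real"
  assumes "f \<in> L2 U" "U \<in> lmeasurable" "bounded U"
  shows "integrable (lebesgue_on U) f"
  using L2_inner_integrable[OF assms(1) continuous_L2[of "\<lambda>_. 1", OF continuous_on_const assms(2,3)]]
  by simp

lemma L2_inner_const:
  fixes f :: "'a::euclidean_space \<Rightarrow> 'b::euclidean_space"
  assumes "f \<in> L2 U" "U \<in> lmeasurable" "bounded U"
  shows "integrable (lebesgue_on U) (\<lambda>x. f x \<bullet> b)"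
  by (rule L2_inner_integrable[OF assms(1) continuous_L2[OF continuous_on_const assms(2,3)]])

text \<open>The fundamental lemma of the calculus of variations. Vanishing integrals pass from test
  functions to indicators of open subsets, then by outer approximation to indicators of measurable
  sets, each time by dominated convergence with majorant |g|. The sets where \<open>g\<close> is
  positive or negative then finish the argument.\<close>

lemma integral_test_functions_zero_imp_AE_zero:
  fixes g :: "'a::euclidean_space \<Rightarrow> real"
  assumes "open U" and g: "integrable (lebesgue_on U) g"
    and zero: "\<And>\<phi>. \<phi> \<in> test_functions U \<Longrightarrow> (LINT x|lebesgue_on U. g x * \<phi> x) = 0"
  shows "AE x in lebesgue_on U. g x = 0"
proof -
  let ?M = "lebesgue_on U"
  have gm [measurable]: "g \<in> borel_measurable ?M" using g by auto
  have U: "U \<in> sets lebesgue" using assms(1) by auto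
  have ind: "indicator V \<in> borel_measurable ?M" if "V \<in> sets lebesgue" for V :: "'a set"
    using that by (intro measurable_restrict_space1) auto
  have op: "(LINT x|?M. g x * indicator V x) = 0" if V: "open V" "V \<subseteq> U" for V
  proof -
    obtain \<phi> where \<phi>: "\<And>n::nat. \<phi> n \<in> test_functions V" "\<And>n x. \<bar>\<phi> n x\<bar> \<le> 1"
      "\<And>x. (\<lambda>n. \<phi> n x) \<longlonglongrightarrow> indicator V x"
      using indicator_open_limit_test_functions[OF V(1)] by metis
    have \<phi>U: "\<phi> n \<in> test_functions U" for n
      using \<phi>(1)[of n] V(2) by (auto simp: test_functions_def)
    have "C_k 0 (\<phi> n)" for n
      using \<phi>(1)[of n] unfolding test_functions_def by blast
    then have [measurable]: "\<phi> n \<in> borel_measurable ?M" for n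
      by (intro continuous_measurable_lebesgue_on) simp
    have [measurable]: "indicator V \<in> borel_measurable ?M"
      using V by (intro ind) auto
    have "(\<lambda>n. LINT x|?M. g x * \<phi> n x) \<longlonglongrightarrow> (LINT x|?M. g x * indicator V x)"
    proof (rule integral_dominated_convergence[where w="\<lambda>x. \<bar>g x\<bar>"])
      show "AE x in ?M. (\<lambda>n. g x * \<phi> n x) \<longlonglongrightarrow> g x * indicator V x"
        using \<phi>(3) by (intro AE_I2 tendsto_intros)
      show "AE x in ?M. norm (g x * \<phi> n x) \<le> \<bar>g x\<bar>" for n
        using \<phi>(2)[of n] by (intro AE_I2) (auto simp: abs_mult intro: mult_left_le)
    qed (use g in auto)
    then show ?thesis
      using zero[OF \<phi>U] by (simp add: LIMSEQ_const_iff)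
  qed
  have meas: "(LINT x|?M. g x * indicator E x) = 0" if E: "E \<in> sets lebesgue" for E
  proof -
    obtain C T where CT: "gdelta C" "T \<in> null_sets lebesgue" "E \<union> T = C"
      using lebesgue_set_almost_gdelta[OF E] by metis
    then obtain F :: "nat \<Rightarrow> 'a set" where F: "\<And>n. open (F n)" "C = \<Inter>(range F)"
      using CT(1) unfolding gdelta.simps by blast
    \<comment> \<open>Finite intersections keep the sets open and make them decrease to
      \<open>C\<close> within \<open>U\<close>; cutting with \<open>U\<close> makes
      \<open>op\<close> applicable.\<close>
    define V where "V n = (\<Inter>i\<le>n. F i) \<inter> U" for n
    have V: "open (V n)" "V n \<subseteq> U" for n
      using F(1) assms(1) by (auto simp: V_def intro!: open_INT)
    have [measurable]: "indicator (V n) \<in> borel_measurable ?M" for n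
      using V by (intro ind) auto
    have C: "C \<in> sets lebesgue" using F by auto
    note [measurable] = ind[OF C] ind[OF E]
    have "(\<lambda>n. LINT x|?M. g x * indicator (V n) x) \<longlonglongrightarrow> (LINT x|?M. g x * indicator C x)"
    proof (rule integral_dominated_convergence[where w="\<lambda>x. \<bar>g x\<bar>"])
      have "(\<lambda>n. indicator (V n) x :: real) \<longlonglongrightarrow> indicator C x" if "x \<in> U" for x
      proof (cases "x \<in> C")
        case True
        then have "x \<in> V n" for n using that F(2) by (auto simp: V_def)
        with True show ?thesis by simp
      next
        case False
        then obtain i where "x \<notin> F i" using F(2) by auto
        then have "x \<notin> V n" if "n \<ge> i" for n using that by (auto simp: V_def)
        then have "\<forall>\<^sub>F n in sequentially. (indicator C x :: real) = indicator (V n) x"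
          using False by (auto simp: eventually_sequentially intro!: exI[of _ i])
        then show ?thesis by (rule Lim_transform_eventually[OF tendsto_const])
      qed
      then show "AE x in ?M. (\<lambda>n. g x * indicator (V n) x) \<longlonglongrightarrow> g x * indicator C x"
        by (intro AE_I2 tendsto_intros) auto
      show "AE x in ?M. norm (g x * indicator (V n) x) \<le> \<bar>g x\<bar>" for n
        by (intro AE_I2) (auto simp: indicator_def)
    qed (use g in auto)
    then have C0: "(LINT x|?M. g x * indicator C x) = 0"
      using op[OF V] by (simp add: LIMSEQ_const_iff)
    have "AE x in lebesgue. x \<notin> T"
      using AE_not_in[OF CT(2)] .
    then have "AE x in ?M. x \<notin> T"
      using U by (auto simp: AE_restrict_space_iff)
    then have "AE x in ?M. g x * indicator C x = g x * indicator E x"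
      by eventually_elim (use CT(3) in \<open>auto simp: indicator_def\<close>)
    then have "(LINT x|?M. g x * indicator C x) = (LINT x|?M. g x * indicator E x)"
      by (rule integral_cong_AE[rotated 2]) measurable
    with C0 show ?thesis by simp
  qed
  \<comment> \<open>Used with s = 1 and s = -1, so one argument excludes both signs of
    \<open>g\<close>.\<close>
  have half: "AE x in ?M. s * g x \<le> 0" for s :: real
  proof -
    define E where "E = {x \<in> space ?M. s * g x > 0}"
    have "E \<in> sets ?M" unfolding E_def by measurable
    then have E: "E \<in> sets lebesgue"
      using U by (auto simp: sets_restrict_space_iff)
    have "(LINT x|?M. s * (g x * indicator E x)) = 0"
      by (simp add: meas[OF E])
    moreover have "integrable ?M (\<lambda>x. s * (g x * indicator E x))"
      using integrable_real_mult_indicator[OF \<open>E \<in> sets ?M\<close> g] by auto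
    ultimately have "AE x in ?M. s * (g x * indicator E x) = 0"
      by (subst (asm) integral_nonneg_eq_0_iff_AE) (auto simp: E_def indicator_def)
    then show ?thesis
      by (rule AE_mp) (auto intro!: AE_I2 simp: E_def indicator_def)
  qed
  from half[of 1] half[of "-1"] show ?thesis by eventually_elim auto
qed

section \<open>Integration by parts\<close>

lemma integrable_lborel_bounded_support:
  fixes h :: "'a::euclidean_space \<Rightarrow> real"
  assumes "h \<in> borel_measurable borel" "\<And>x. \<bar>h x\<bar> \<le> M * indicator (cball 0 R) x"
  shows "integrable lborel h"
proof (rule Bochner_Integration.integrable_bound)
  show "integrable lborel (\<lambda>x. M * indicator (cball 0 R) (x::'a))"
    using emeasure_bounded_finite[of "cball 0 R :: 'a set"] by auto
  show "AE x in lborel. norm (h x) \<le> norm (M * indicator (cball 0 R) x)"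
  proof (rule AE_I2)
    fix x :: 'a
    show "norm (h x) \<le> norm (M * indicator (cball 0 R) x)"
      using assms(2)[of x] abs_ge_self[of "M * indicator (cball 0 R) x"] by (metis order_trans real_norm_def)
  qed
qed (use assms in auto)

lemma continuous_compact_support_bound:
  fixes h :: "'a::euclidean_space \<Rightarrow> real"
  assumes "continuous_on UNIV h" "compact S" "\<And>x. x \<notin> S \<Longrightarrow> h x = 0"
  obtains M where "M \<ge> 0" "\<And>x. \<bar>h x\<bar> \<le> M"
proof -
  have "compact (h ` S)"
    using assms by (intro compact_continuous_image) (auto intro: continuous_on_subset)
  then obtain M where M: "\<And>x. x \<in> S \<Longrightarrow> \<bar>h x\<bar> \<le> M"
    using compact_imp_bounded bounded_iff by (metis imageI real_norm_def)
  have "\<bar>h x\<bar> \<le> max M 0" for x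
    using M[of x] assms(3)[of x] by (cases "x \<in> S") auto
  then show ?thesis by (intro that[of "max M 0"]) auto
qed

lemma continuous_compact_support_integrable:
  fixes h :: "'a::euclidean_space \<Rightarrow> real"
  assumes "continuous_on UNIV h" "compact S" "\<And>x. x \<notin> S \<Longrightarrow> h x = 0"
  shows "integrable lborel h"
proof -
  obtain M where M: "M \<ge> 0" "\<And>x. \<bar>h x\<bar> \<le> M"
    using continuous_compact_support_bound[OF assms] by metis
  obtain R where R: "S \<subseteq> cball 0 R"
    using compact_imp_bounded[OF assms(2)] unfolding bounded_iff by (metis mem_cball_0 subsetI)
  have "\<bar>h x\<bar> \<le> M * indicator (cball 0 R) x" for x
    using M(1) M(2)[of x] assms(3)[of x] subsetD[OF R, of x] by (cases "x \<in> S") simp_all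
  then show ?thesis
    by (intro integrable_lborel_bounded_support borel_measurable_continuous_onI assms)
qed

lemma frechet_derivative_support:
  assumes "closed S" "\<And>x. x \<notin> S \<Longrightarrow> g x = 0" "x \<notin> S"
  shows "frechet_derivative g (at x) b = (0::real)"
proof -
  have "(g has_derivative (\<lambda>_. 0)) (at x)"
    by (rule has_derivative_transform_within_open[of "\<lambda>_. 0" _ _ UNIV "- S"])
       (use assms in auto)
  from frechet_derivative_at[OF this] show ?thesis by metis
qed

lemma directional_derivative:
  assumes "C_k (Suc 0) g"
  shows "((\<lambda>t. g (x + t *\<^sub>R b)) has_real_derivative frechet_derivative g (at (x + t *\<^sub>R b)) b) (at t)"
proof -
  have "((\<lambda>t. x + t *\<^sub>R b) has_derivative (\<lambda>t. t *\<^sub>R b)) (at t)"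
    by (auto intro!: derivative_eq_intros)
  from has_derivative_compose[OF this C_k_Suc_has_derivative[OF assms]]
  have "((\<lambda>t. g (x + t *\<^sub>R b)) has_derivative
          (\<lambda>s. frechet_derivative g (at (x + t *\<^sub>R b)) (s *\<^sub>R b))) (at t)" .
  moreover have "frechet_derivative g (at (x + t *\<^sub>R b)) (s *\<^sub>R b)
      = s * frechet_derivative g (at (x + t *\<^sub>R b)) b" for s
    using linear_cmul[OF has_derivative_linear[OF C_k_Suc_has_derivative[OF assms]]] by simp
  ultimately show ?thesis
    by (simp add: has_field_derivative_def mult.commute[of _ "frechet_derivative _ _ _"])
qed

text \<open>By translation invariance the difference quotients of \<open>g\<close> integrate to zero, and they converge
  boundedly to the directional derivative.\<close>
lemma integral_frechet_derivative_compact_support: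
  fixes g :: "'a::euclidean_space \<Rightarrow> real"
  assumes g: "C_k (Suc 0) g" and S: "compact S" "\<And>x. x \<notin> S \<Longrightarrow> g x = 0" and b: "b \<in> Basis"
  shows "(LINT x|lborel. frechet_derivative g (at x) b) = 0"
proof -
  define D where "D x = frechet_derivative g (at x) b" for x
  have cont_D: "continuous_on UNIV D"
    using g b by (auto simp: D_def[abs_def])
  have cont_g: "continuous_on UNIV g"
    using C_k_Suc_imp[OF g] by simp
  note [measurable] = borel_measurable_continuous_onI[OF cont_D] borel_measurable_continuous_onI[OF cont_g]
  have D0: "D x = 0" if "x \<notin> S" for x
    using frechet_derivative_support[OF compact_imp_closed[OF S(1)] S(2) that] by (simp add: D_def)
  obtain M where M: "M \<ge> 0" "\<And>x. \<bar>D x\<bar> \<le> M"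
    using continuous_compact_support_bound[OF cont_D S(1) D0] by metis
  obtain R where R: "S \<subseteq> cball 0 R"
    using compact_imp_bounded[OF S(1)] unfolding bounded_iff by (metis mem_cball_0 subsetI)
  have g_int: "integrable lborel g"
    by (rule continuous_compact_support_integrable[OF cont_g S])
  define q where "q n x = (g (x + (1 / real (Suc n)) *\<^sub>R b) - g x) * real (Suc n)" for n x
  have [measurable]: "q n \<in> borel_measurable borel" for n
    unfolding q_def[abs_def] by measurable
  \<comment> \<open>Inside the ball the mean value theorem turns the quotient into a value of
    \<open>D\<close>. The radius \<open>R + 1\<close> leaves room for a shift of length at most 1,
    so outside that ball both points miss \<open>S\<close>.\<close>
  have q_bound: "\<bar>q n x\<bar> \<le> M * indicator (cball 0 (R + 1)) x" for n x
  proof (cases "x \<in> cball 0 (R + 1)")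
    case True
    define h where "h = 1 / real (Suc n)"
    have h: "h > 0" by (simp add: h_def)
    obtain z where "g (x + h *\<^sub>R b) - g (x + 0 *\<^sub>R b) = (h - 0) * D (x + z *\<^sub>R b)"
      using MVT2[of 0 h "\<lambda>t. g (x + t *\<^sub>R b)" "\<lambda>t. D (x + t *\<^sub>R b)"]
        directional_derivative[OF g, of x b] h unfolding D_def by blast
    then have "q n x = h * D (x + z *\<^sub>R b) * real (Suc n)"
      unfolding q_def h_def by simp
    then have "q n x = D (x + z *\<^sub>R b)"
      by (simp add: h_def)
    with M(2) True show ?thesis by simp
  next
    case False
    have "norm ((1 / real (Suc n)) *\<^sub>R b) \<le> 1"
      using b by simp
    then have "x + (1 / real (Suc n)) *\<^sub>R b \<notin> cball 0 R"
      using False norm_diff_ineq[of x "(1 / real (Suc n)) *\<^sub>R b"] unfolding mem_cball_0 by linarith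
    moreover have "x \<notin> cball 0 R" using False by auto
    ultimately have "x + (1 / real (Suc n)) *\<^sub>R b \<notin> S" "x \<notin> S" using R by blast+
    then have "q n x = 0" by (simp add: q_def S(2))
    with M(1) show ?thesis by simp
  qed
  have q_int: "(LINT x|lborel. q n x) = 0" for n
  proof -
    let ?c = "(1 / real (Suc n)) *\<^sub>R b"
    have tr: "integrable lborel (\<lambda>x. g (?c + x))" "(LINT x|lborel. g (?c + x)) = (LINT x|lborel. g x)"
      using integrable_distr_eq[of "(+) ?c" lborel borel g] integral_distr[of "(+) ?c" lborel borel g]
        g_int lborel_distr_plus[of ?c] by simp_all
    have "(LINT x|lborel. q n x) = (LINT x|lborel. (g (?c + x) - g x) * real (Suc n))"
      by (simp only: q_def add.commute)
    also have "\<dots> = ((LINT x|lborel. g (?c + x)) - (LINT x|lborel. g x)) * real (Suc n)"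
      using tr(1) g_int by simp
    finally show ?thesis using tr(2) by simp
  qed
  have "(\<lambda>n. LINT x|lborel. q n x) \<longlonglongrightarrow> (LINT x|lborel. D x)"
  proof (rule integral_dominated_convergence[where w="\<lambda>x. M * indicator (cball 0 (R + 1)) x"])
    show "integrable lborel (\<lambda>x::'a. M * indicator (cball 0 (R + 1)) x)"
      using emeasure_bounded_finite[of "cball 0 (R + 1) :: 'a set"] by auto
    have "(\<lambda>n. q n x) \<longlonglongrightarrow> D x" for x
    proof -
      have "((\<lambda>t. (g (x + t *\<^sub>R b) - g x) / t) \<longlongrightarrow> D x) (at 0)"
        using directional_derivative[OF g, of x b 0] by (simp add: has_field_derivative_iff D_def)
      moreover have "filterlim (\<lambda>n. 1 / real (Suc n)) (at 0) sequentially"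
        using LIMSEQ_inverse_real_of_nat by (auto simp: filterlim_at inverse_eq_divide)
      ultimately have "(\<lambda>n. (g (x + (1 / real (Suc n)) *\<^sub>R b) - g x) / (1 / real (Suc n))) \<longlonglongrightarrow> D x"
        by (rule filterlim_compose)
      then show ?thesis by (simp add: q_def[abs_def])
    qed
    then show "AE x in lborel. (\<lambda>n. q n x) \<longlonglongrightarrow> D x" by simp
    show "AE x in lborel. norm (q n x) \<le> M * indicator (cball 0 (R + 1)) x" for n
      using q_bound by simp
  qed auto
  then show ?thesis
    using q_int by (simp add: LIMSEQ_const_iff D_def)
qed

section \<open>Classical gradients as weak gradients\<close>

definition classical_gradient :: "('a::euclidean_space \<Rightarrow> real) \<Rightarrow> 'a \<Rightarrow> 'a" where
  "classical_gradient p x = (\<Sum>b\<in>Basis. frechet_derivative p (at x) b *\<^sub>R b)"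

lemma classical_gradient_inner [simp]:
  "b \<in> Basis \<Longrightarrow> classical_gradient p x \<bullet> b = frechet_derivative p (at x) b"
  by (simp add: classical_gradient_def)

lemma continuous_classical_gradient: "C_k (Suc 0) p \<Longrightarrow> continuous_on UNIV (classical_gradient p)"
  unfolding classical_gradient_def[abs_def] by (intro continuous_intros) auto

lemma lebesgue_on_integral_compact_support:
  fixes h :: "'a::euclidean_space \<Rightarrow> real"
  assumes "continuous_on UNIV h" "S \<subseteq> U" "\<And>x. x \<notin> S \<Longrightarrow> h x = 0" "U \<in> sets lebesgue"
  shows "(LINT x|lebesgue_on U. h x) = (LINT x|lborel. h x)"
proof -
  have "(\<lambda>x. indicator U x *\<^sub>R h x) = h"
    using assms(2,3) by (auto simp: indicator_def fun_eq_iff)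
  then show ?thesis
    using assms(4) borel_measurable_continuous_onI[OF assms(1)]
    by (simp add: integral_restrict_space integral_completion)
qed

text \<open>The product \<open>p x * \<phi> x\<close> has compact support, so its derivative
  integrates to zero over the whole space, and the product rule splits that integral. Both
  integrands vanish off the support of \<phi>, which lies in \<open>U\<close>, so integrals over
  \<open>U\<close> and over the space agree.\<close>

lemma integration_by_parts:
  fixes p \<phi> :: "'a::euclidean_space \<Rightarrow> real"
  assumes p: "C_k (Suc 0) p" and \<phi>: "\<phi> \<in> test_functions U" and U: "U \<in> sets lebesgue" and b: "b \<in> Basis"
  shows "(LINT x|lebesgue_on U. p x * frechet_derivative \<phi> (at x) b)
       = - (LINT x|lebesgue_on U. frechet_derivative p (at x) b * \<phi> x)"
proof -
  obtain S where S: "\<And>k. C_k k \<phi>" "compact S" "S \<subseteq> U" "\<And>x. x \<notin> S \<Longrightarrow> \<phi> x = 0"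
    using \<phi> test_functionsD by blast
  let ?Dp = "\<lambda>x. frechet_derivative p (at x) b" and ?D\<phi> = "\<lambda>x. frechet_derivative \<phi> (at x) b"
  have D0: "?D\<phi> x = 0" if "x \<notin> S" for x
    by (rule frechet_derivative_support[OF compact_imp_closed[OF S(2)] S(4) that])
  have c: "continuous_on UNIV p" "continuous_on UNIV \<phi>" "continuous_on UNIV ?Dp" "continuous_on UNIV ?D\<phi>"
    using p b S(1)[of 0] S(1)[of "Suc 0"] C_k_Suc_imp[OF p] by auto
  have "((\<lambda>x. p x * \<phi> x) has_derivative
      (\<lambda>h. p x * frechet_derivative \<phi> (at x) h + frechet_derivative p (at x) h * \<phi> x)) (at x)" for x
    by (rule has_derivative_mult[OF C_k_Suc_has_derivative[OF p] C_k_Suc_has_derivative[OF S(1)]])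
  from frechet_derivative_at[OF this]
  have eq: "frechet_derivative (\<lambda>x. p x * \<phi> x) (at x) b = p x * ?D\<phi> x + ?Dp x * \<phi> x" for x
    by (rule fun_cong[THEN sym])
  have "(LINT x|lborel. frechet_derivative (\<lambda>x. p x * \<phi> x) (at x) b) = 0"
    by (rule integral_frechet_derivative_compact_support[OF C_k_mult[OF p S(1)] S(2) _ b])
       (simp add: S(4))
  then have "(LINT x|lborel. p x * ?D\<phi> x + ?Dp x * \<phi> x) = 0"
    by (simp only: eq)
  moreover have "integrable lborel (\<lambda>x. p x * ?D\<phi> x)"
    by (rule continuous_compact_support_integrable[OF _ S(2)])
       (use c D0 in \<open>auto intro: continuous_on_mult\<close>)
  moreover have "integrable lborel (\<lambda>x. ?Dp x * \<phi> x)"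
    by (rule continuous_compact_support_integrable[OF _ S(2)])
       (use c S(4) in \<open>auto intro: continuous_on_mult\<close>)
  ultimately have "(LINT x|lborel. p x * ?D\<phi> x) = - (LINT x|lborel. ?Dp x * \<phi> x)"
    by simp
  moreover have "(LINT x|lebesgue_on U. p x * ?D\<phi> x) = (LINT x|lborel. p x * ?D\<phi> x)"
    by (rule lebesgue_on_integral_compact_support[OF _ S(3) _ U])
       (use c D0 in \<open>auto intro: continuous_on_mult\<close>)
  moreover have "(LINT x|lebesgue_on U. ?Dp x * \<phi> x) = (LINT x|lborel. ?Dp x * \<phi> x)"
    by (rule lebesgue_on_integral_compact_support[OF _ S(3) _ U])
       (use c S(4) in \<open>auto intro: continuous_on_mult\<close>)
  ultimately show ?thesis by simp
qed

lemma has_weak_gradient_classical: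
  assumes "C_k (Suc 0) p" "U \<in> sets lebesgue"
  shows "has_weak_gradient U p (classical_gradient p)"
  unfolding has_weak_gradient_def using integration_by_parts[OF assms(1) _ assms(2)] by simp

lemma has_weak_gradient_cong:
  assumes "\<And>x. x \<in> U \<Longrightarrow> v x = w x" "has_weak_gradient U w G"
  shows "has_weak_gradient U v G"
proof -
  have "(LINT x|lebesgue_on U. v x * D x) = (LINT x|lebesgue_on U. w x * D x)" for D
    by (rule Bochner_Integration.integral_cong) (use assms(1) in auto)
  with assms(2) show ?thesis by (simp add: has_weak_gradient_def)
qed

section \<open>Weak gradients and the Poincare inequality\<close>

lemma l2_inner_nonneg: "0 \<le> l2_inner U v v"
  unfolding l2_inner_def by (rule integral_nonneg_AE) simp

lemma l2_inner_commute: "l2_inner U v w = l2_inner U w v"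
  by (simp add: l2_inner_def inner_commute)

lemma l2_inner_add_scaleR_right:
  assumes "u \<in> L2 U" "v \<in> L2 U" "w \<in> L2 U"
  shows "l2_inner U u (\<lambda>x. v x + c *\<^sub>R w x) = l2_inner U u v + c * l2_inner U u w"
  using L2_inner_integrable[OF assms(1,2)] L2_inner_integrable[OF assms(1,3)]
  by (simp add: l2_inner_def inner_add_right)

text \<open>The parallelogram law with the nonnegative term for \<open>- c\<close> dropped. It
  replaces the triangle inequality where a factor 2 does no harm, namely in showing that errors tend
  to zero.\<close>

lemma l2_inner_add_scaleR_self_le:
  assumes "v \<in> L2 U" "w \<in> L2 U"
  shows "l2_inner U (\<lambda>x. v x + c *\<^sub>R w x) (\<lambda>x. v x + c *\<^sub>R w x)
      \<le> 2 * l2_inner U v v + 2 * c\<^sup>2 * l2_inner U w w"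
proof -
  have "l2_inner U (\<lambda>x. v x + c *\<^sub>R w x) (\<lambda>x. v x + c *\<^sub>R w x)
      + l2_inner U (\<lambda>x. v x + (- c) *\<^sub>R w x) (\<lambda>x. v x + (- c) *\<^sub>R w x)
      = 2 * l2_inner U v v + 2 * c\<^sup>2 * l2_inner U w w"
    unfolding l2_inner_add_scaleR_right[OF L2_add_scaleR[OF assms] assms]
      l2_inner_commute[of U "\<lambda>x. v x + _ *\<^sub>R w x"]
      l2_inner_add_scaleR_right[OF assms(1) assms] l2_inner_add_scaleR_right[OF assms(2) assms]
    by (simp add: l2_inner_commute[of U w v] algebra_simps power2_eq_square)
  then show ?thesis using l2_inner_nonneg[of U "\<lambda>x. v x + (- c) *\<^sub>R w x"] by linarith
qed

lemma l2_inner_cong_AE: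
  assumes "AE x in lebesgue_on U. v x = v' x" "AE x in lebesgue_on U. w x = w' x"
    and "v \<in> L2 U" "v' \<in> L2 U" "w \<in> L2 U" "w' \<in> L2 U"
  shows "l2_inner U v w = l2_inner U v' w'"
  unfolding l2_inner_def
proof (rule integral_cong_AE)
  show "AE x in lebesgue_on U. v x \<bullet> w x = v' x \<bullet> w' x"
    using assms(1,2) by eventually_elim simp
qed (use L2_inner_integrable assms in auto)

lemma l2_inner_self_eq_0:
  assumes "v \<in> L2 U"
  shows "l2_inner U v v = 0 \<longleftrightarrow> (AE x in lebesgue_on U. v x = 0)"
  using integral_nonneg_eq_0_iff_AE[OF L2_inner_integrable[OF assms assms]]
  by (simp add: l2_inner_def)

lemma h1_norm_power2:
  "(h1_norm U v)\<^sup>2 = l2_inner U v v + l2_inner U (grad U v) (grad U v)"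
  by (simp add: h1_norm_def l2_inner_nonneg)

lemma has_weak_gradientD:
  assumes "has_weak_gradient U v G" "\<phi> \<in> test_functions U" "b \<in> Basis"
  shows "(LINT x|lebesgue_on U. v x * frechet_derivative \<phi> (at x) b)
    = - (LINT x|lebesgue_on U. (G x \<bullet> b) * \<phi> x)"
  using assms unfolding has_weak_gradient_def by blast

lemma grad_of_H1:
  assumes "v \<in> H1 U"
  shows "grad U v \<in> L2 U" "has_weak_gradient U v (grad U v)"
proof -
  have "\<exists>G. G \<in> L2 U \<and> has_weak_gradient U v G" using assms by (auto simp: H1_def)
  from someI_ex[OF this] show "grad U v \<in> L2 U" "has_weak_gradient U v (grad U v)"
    unfolding grad_def by auto
qed

section \<open>Weak gradients and Sobolev functions on a bounded open set\<close>

context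
  fixes U :: "'a::euclidean_space set"
  assumes U: "open U" "bounded U"
begin

lemma bounded_open_lmeasurable: "U \<in> lmeasurable" "U \<in> sets lebesgue"
  using lmeasurable_open[OF U(2,1)] U(1) by auto

lemma test_function_L2:
  assumes "\<phi> \<in> test_functions U"
  shows "\<phi> \<in> L2 U" "b \<in> Basis \<Longrightarrow> (\<lambda>x. frechet_derivative \<phi> (at x) b) \<in> L2 U"
proof -
  have "C_k 0 \<phi>" "C_k (Suc 0) \<phi>"
    using assms unfolding test_functions_def by blast+
  then show "\<phi> \<in> L2 U" "b \<in> Basis \<Longrightarrow> (\<lambda>x. frechet_derivative \<phi> (at x) b) \<in> L2 U"
    by (auto intro!: continuous_L2 U bounded_open_lmeasurable)
qed

lemma inner_mult_test_integrable:
  assumes "G \<in> L2 U" "\<phi> \<in> test_functions U"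
  shows "integrable (lebesgue_on U) (\<lambda>x. (G x \<bullet> b) * \<phi> x)"
proof -
  have "C_k 0 \<phi>" using assms unfolding test_functions_def by blast
  then have "(\<lambda>x. \<phi> x *\<^sub>R b) \<in> L2 U"
    by (intro continuous_L2 U bounded_open_lmeasurable) (auto intro: continuous_intros)
  from L2_inner_integrable[OF assms(1) this] show ?thesis by (simp add: mult.commute)
qed

lemma mult_test_derivative_integrable:
  assumes "v \<in> L2 U" "\<phi> \<in> test_functions U" "b \<in> Basis"
  shows "integrable (lebesgue_on U) (\<lambda>x. v x * frechet_derivative \<phi> (at x) b)"
  using L2_inner_integrable[OF assms(1) test_function_L2(2)[OF assms(2,3)]] by simp

text \<open>Each component of \<open>G x - H x\<close> integrates to zero against every test
  function. Allowing \<open>v\<close> and \<open>w\<close> to differ on a null set gives, with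
  \<open>w\<close> zero, that null functions have null gradients.\<close>

lemma has_weak_gradient_unique:
  assumes v: "v \<in> L2 U" "w \<in> L2 U" "AE x in lebesgue_on U. v x = w x"
    and G: "G \<in> L2 U" "has_weak_gradient U v G" and H: "H \<in> L2 U" "has_weak_gradient U w H"
  shows "AE x in lebesgue_on U. G x = H x"
proof -
  have "AE x in lebesgue_on U. (G x - H x) \<bullet> b = 0" if b: "b \<in> Basis" for b
  proof (rule integral_test_functions_zero_imp_AE_zero[OF U(1)])
    have "(\<lambda>x. G x - H x) \<in> L2 U"
      using L2_add_scaleR[OF G(1) H(1), of "-1"] by simp
    then show "integrable (lebesgue_on U) (\<lambda>x. (G x - H x) \<bullet> b)"
      by (rule L2_inner_const[OF _ bounded_open_lmeasurable(1) U(2)])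
    fix \<phi> assume \<phi>: "\<phi> \<in> test_functions U"
    have "(LINT x|lebesgue_on U. v x * frechet_derivative \<phi> (at x) b)
        = (LINT x|lebesgue_on U. w x * frechet_derivative \<phi> (at x) b)"
    proof (rule integral_cong_AE)
      show "AE x in lebesgue_on U. v x * frechet_derivative \<phi> (at x) b = w x * frechet_derivative \<phi> (at x) b"
        using v(3) by eventually_elim simp
    qed (use mult_test_derivative_integrable[OF _ \<phi> b] v in auto)
    then have "(LINT x|lebesgue_on U. (G x \<bullet> b) * \<phi> x) = (LINT x|lebesgue_on U. (H x \<bullet> b) * \<phi> x)"
      using has_weak_gradientD[OF G(2) \<phi> b] has_weak_gradientD[OF H(2) \<phi> b] by linarith
    then show "(LINT x|lebesgue_on U. (G x - H x) \<bullet> b * \<phi> x) = 0"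
      using inner_mult_test_integrable[OF G(1) \<phi>] inner_mult_test_integrable[OF H(1) \<phi>]
      by (simp add: inner_diff_left left_diff_distrib)
  qed
  then have "AE x in lebesgue_on U. \<forall>b\<in>Basis. (G x - H x) \<bullet> b = 0"
    by (subst AE_ball_countable) (simp_all add: countable_finite)
  then show ?thesis
    by eventually_elim (auto simp: inner_diff_left intro: euclidean_eqI)
qed

lemma has_weak_gradient_add_scale:
  assumes v: "v \<in> L2 U" "w \<in> L2 U"
    and G: "G \<in> L2 U" "has_weak_gradient U v G" and H: "H \<in> L2 U" "has_weak_gradient U w H"
  shows "has_weak_gradient U (\<lambda>x. v x + c * w x) (\<lambda>x. G x + c *\<^sub>R H x)"
  unfolding has_weak_gradient_def
proof (intro ballI)
  fix \<phi> and b :: 'a assume \<phi>: "\<phi> \<in> test_functions U" and b: "b \<in> Basis"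
  let ?D = "\<lambda>x. frechet_derivative \<phi> (at x) b"
  have "(LINT x|lebesgue_on U. (v x + c * w x) * ?D x)
      = (LINT x|lebesgue_on U. v x * ?D x) + c * (LINT x|lebesgue_on U. w x * ?D x)"
    using mult_test_derivative_integrable[OF v(1) \<phi> b] mult_test_derivative_integrable[OF v(2) \<phi> b]
    by (simp add: distrib_right mult.assoc)
  also have "\<dots> = - ((LINT x|lebesgue_on U. (G x \<bullet> b) * \<phi> x) + c * (LINT x|lebesgue_on U. (H x \<bullet> b) * \<phi> x))"
    using has_weak_gradientD[OF G(2) \<phi> b] has_weak_gradientD[OF H(2) \<phi> b] by simp
  also have "\<dots> = - (LINT x|lebesgue_on U. (G x + c *\<^sub>R H x) \<bullet> b * \<phi> x)"
    using inner_mult_test_integrable[OF G(1) \<phi>] inner_mult_test_integrable[OF H(1) \<phi>]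
    by (simp add: inner_add_left distrib_right mult.assoc)
  finally show "(LINT x|lebesgue_on U. (v x + c * w x) * ?D x)
      = - (LINT x|lebesgue_on U. (G x + c *\<^sub>R H x) \<bullet> b * \<phi> x)" .
qed

lemma H1_add_scale:
  assumes "v \<in> H1 U" "w \<in> H1 U"
  shows "(\<lambda>x. v x + c * w x) \<in> H1 U"
    and "AE x in lebesgue_on U. grad U (\<lambda>x. v x + c * w x) x = grad U v x + c *\<^sub>R grad U w x"
proof -
  have L2: "v \<in> L2 U" "w \<in> L2 U" using assms by (auto simp: H1_def)
  note G = grad_of_H1[OF assms(1)] and H = grad_of_H1[OF assms(2)]
  have sum: "(\<lambda>x. v x + c * w x) \<in> L2 U" using L2_add_scaleR[OF L2, of c] by simp
  have grad_sum: "(\<lambda>x. grad U v x + c *\<^sub>R grad U w x) \<in> L2 U"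
    by (rule L2_add_scaleR[OF G(1) H(1)])
  note weak = has_weak_gradient_add_scale[OF L2 G H, of c]
  show H1: "(\<lambda>x. v x + c * w x) \<in> H1 U"
    using sum grad_sum weak unfolding H1_def by blast
  show "AE x in lebesgue_on U. grad U (\<lambda>x. v x + c * w x) x = grad U v x + c *\<^sub>R grad U w x"
    by (rule has_weak_gradient_unique[OF sum sum _ grad_of_H1[OF H1] grad_sum weak]) simp
qed

lemma C1_in_H1:
  assumes "C_k (Suc 0) p"
  shows "p \<in> H1 U" "AE x in lebesgue_on U. grad U p x = classical_gradient p x"
    "classical_gradient p \<in> L2 U"
proof -
  have p: "p \<in> L2 U"
    using C_k_Suc_imp[OF assms] by (intro continuous_L2 U bounded_open_lmeasurable) simp
  show G: "classical_gradient p \<in> L2 U"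
    by (intro continuous_L2 U bounded_open_lmeasurable continuous_classical_gradient assms)
  note weak = has_weak_gradient_classical[OF assms bounded_open_lmeasurable(2)]
  show H1: "p \<in> H1 U" using p G weak unfolding H1_def by blast
  show "AE x in lebesgue_on U. grad U p x = classical_gradient p x"
    by (rule has_weak_gradient_unique[OF p p _ grad_of_H1[OF H1] G weak]) simp
qed

lemma h1_norm_add_scale:
  assumes "v \<in> H1 U" "w \<in> H1 U"
  shows "(h1_norm U (\<lambda>x. v x + c * w x))\<^sup>2 \<le> 2 * (h1_norm U v)\<^sup>2 + 2 * c\<^sup>2 * (h1_norm U w)\<^sup>2"
proof -
  have L2: "v \<in> L2 U" "w \<in> L2 U" using assms by (auto simp: H1_def)
  note G = grad_of_H1(1)[OF assms(1)] and H = grad_of_H1(1)[OF assms(2)]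
  note sum = H1_add_scale[OF assms, of c]
  have "l2_inner U (grad U (\<lambda>x. v x + c * w x)) (grad U (\<lambda>x. v x + c * w x))
      = l2_inner U (\<lambda>x. grad U v x + c *\<^sub>R grad U w x) (\<lambda>x. grad U v x + c *\<^sub>R grad U w x)"
    by (rule l2_inner_cong_AE[OF sum(2) sum(2)])
       (use L2_add_scaleR[OF G H] grad_of_H1(1)[OF sum(1)] in auto)
  also have "\<dots> \<le> 2 * l2_inner U (grad U v) (grad U v) + 2 * c\<^sup>2 * l2_inner U (grad U w) (grad U w)"
    by (rule l2_inner_add_scaleR_self_le[OF G H])
  finally show ?thesis
    using l2_inner_add_scaleR_self_le[OF L2, of c]
    by (simp add: h1_norm_power2 distrib_left)
qed

lemma test_function_H1:
  assumes "\<phi> \<in> test_functions U"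
  shows "\<phi> \<in> H1 U" "AE x in lebesgue_on U. grad U \<phi> x = classical_gradient \<phi> x"
    "classical_gradient \<phi> \<in> L2 U"
  using C1_in_H1[of \<phi>] assms unfolding test_functions_def by blast+

lemma H1_0_add_scale:
  assumes "v \<in> H1_0 U" "w \<in> H1_0 U"
  shows "(\<lambda>x. v x + c * w x) \<in> H1_0 U"
proof -
  obtain \<phi> \<psi> where \<phi>: "\<And>k::nat. \<phi> k \<in> test_functions U" "(\<lambda>k. h1_norm U (\<lambda>x. v x - \<phi> k x)) \<longlonglongrightarrow> 0"
    and \<psi>: "\<And>k::nat. \<psi> k \<in> test_functions U" "(\<lambda>k. h1_norm U (\<lambda>x. w x - \<psi> k x)) \<longlonglongrightarrow> 0"
    using assms unfolding H1_0_def by blast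
  have H1: "v \<in> H1 U" "w \<in> H1 U" using assms by (auto simp: H1_0_def)
  let ?e = "\<lambda>k. h1_norm U (\<lambda>x. (v x + c * w x) - (\<phi> k x + c * \<psi> k x))"
  \<comment> \<open>The error is estimated in squared norms, where the factor 2 bound holds; the
    square is removed after passing to the limit.\<close>
  have le: "(?e k)\<^sup>2 \<le> 2 * (h1_norm U (\<lambda>x. v x - \<phi> k x))\<^sup>2 + 2 * c\<^sup>2 * (h1_norm U (\<lambda>x. w x - \<psi> k x))\<^sup>2" for k
  proof -
    have "(\<lambda>x. v x - \<phi> k x) \<in> H1 U" "(\<lambda>x. w x - \<psi> k x) \<in> H1 U"
      using H1_add_scale(1)[OF H1(1) test_function_H1(1)[OF \<phi>(1)], of "-1"]
        H1_add_scale(1)[OF H1(2) test_function_H1(1)[OF \<psi>(1)], of "-1"] by simp_all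
    from h1_norm_add_scale[OF this, of c] show ?thesis
      by (simp add: algebra_simps)
  qed
  have "(\<lambda>k. 2 * (h1_norm U (\<lambda>x. v x - \<phi> k x))\<^sup>2 + 2 * c\<^sup>2 * (h1_norm U (\<lambda>x. w x - \<psi> k x))\<^sup>2)
      \<longlonglongrightarrow> 2 * 0\<^sup>2 + 2 * c\<^sup>2 * 0\<^sup>2"
    by (intro tendsto_intros \<phi> \<psi>)
  then have upper: "(\<lambda>k. 2 * (h1_norm U (\<lambda>x. v x - \<phi> k x))\<^sup>2 + 2 * c\<^sup>2 * (h1_norm U (\<lambda>x. w x - \<psi> k x))\<^sup>2)
      \<longlonglongrightarrow> 0"
    by simp
  have "(\<lambda>k. (?e k)\<^sup>2) \<longlonglongrightarrow> 0"
    by (rule tendsto_sandwich[OF _ _ tendsto_const upper])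
       (use le in \<open>simp_all add: always_eventually\<close>)
  then have "?e \<longlonglongrightarrow> 0"
    by simp
  moreover have "(\<lambda>x. \<phi> k x + c * \<psi> k x) \<in> test_functions U" for k
    by (rule test_functions_add_scale[OF \<phi>(1) \<psi>(1)])
  ultimately show ?thesis
    using H1_add_scale(1)[OF H1, of c] unfolding H1_0_def
    by (auto intro!: exI[of _ "\<lambda>k x. \<phi> k x + c * \<psi> k x"])
qed

text \<open>Fix a coordinate direction b. Integrating by parts with the multiplier x.b, whose
  derivative in direction b is 1, writes the integral of \<phi>^2 as -2 times that of \<phi> (x.b)
  D\<phi>, and |x.b| is at most \<open>R\<close> on \<open>U\<close>.\<close>

lemma Poincare_test_function:
  assumes "\<phi> \<in> test_functions U" "U \<subseteq> cball 0 R"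
  shows "l2_inner U \<phi> \<phi> \<le> 4 * R\<^sup>2 * l2_inner U (classical_gradient \<phi>) (classical_gradient \<phi>)"
proof -
  obtain b :: 'a where b: "b \<in> Basis" using nonempty_Basis by blast
  have \<phi>: "C_k 0 \<phi>" "C_k (Suc 0) \<phi>" using assms unfolding test_functions_def by blast+
  let ?D = "\<lambda>x. frechet_derivative \<phi> (at x) b"
  have p: "C_k (Suc 0) (\<lambda>x. \<phi> x * (x \<bullet> b))"
    by (intro C_k_mult C_k_inner \<phi>)
  have "((\<lambda>x. \<phi> x * (x \<bullet> b)) has_derivative
      (\<lambda>h. \<phi> x * (h \<bullet> b) + frechet_derivative \<phi> (at x) h * (x \<bullet> b))) (at x)" for x
    by (rule has_derivative_mult[OF C_k_Suc_has_derivative[OF \<phi>(2)]]) (auto intro!: derivative_eq_intros)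
  from frechet_derivative_at[OF this]
  have Dp: "frechet_derivative (\<lambda>x. \<phi> x * (x \<bullet> b)) (at x) b = \<phi> x * (b \<bullet> b) + ?D x * (x \<bullet> b)" for x
    by (rule fun_cong[THEN sym])
  have c: "continuous_on UNIV \<phi>" "continuous_on UNIV ?D" using \<phi> b by auto
  have int: "integrable (lebesgue_on U) h" if "continuous_on UNIV h" for h :: "'a \<Rightarrow> real"
    by (rule L2_imp_integrable[OF continuous_L2[OF that bounded_open_lmeasurable(1) U(2)] bounded_open_lmeasurable(1) U(2)])
  have i1: "integrable (lebesgue_on U) (\<lambda>x. \<phi> x * (x \<bullet> b) * ?D x)"
    by (intro int continuous_intros c)
  have i2: "integrable (lebesgue_on U) (\<lambda>x. \<phi> x * \<phi> x)"
    by (intro int continuous_intros c)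
  have i3: "integrable (lebesgue_on U) (\<lambda>x. classical_gradient \<phi> x \<bullet> classical_gradient \<phi> x)"
    by (intro int continuous_intros continuous_classical_gradient \<phi>)
  have "(LINT x|lebesgue_on U. \<phi> x * (x \<bullet> b) * ?D x)
      = - (LINT x|lebesgue_on U. (\<phi> x * (b \<bullet> b) + ?D x * (x \<bullet> b)) * \<phi> x)"
    using integration_by_parts[OF p assms(1) bounded_open_lmeasurable(2) b] by (simp only: Dp)
  also have "(\<lambda>x. (\<phi> x * (b \<bullet> b) + ?D x * (x \<bullet> b)) * \<phi> x) = (\<lambda>x. \<phi> x * \<phi> x + \<phi> x * (x \<bullet> b) * ?D x)"
    using b by (auto simp: algebra_simps)
  finally have eq: "(LINT x|lebesgue_on U. \<phi> x * \<phi> x) = (LINT x|lebesgue_on U. - 2 * (\<phi> x * (x \<bullet> b) * ?D x))"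
    using i1 i2 by simp
  \<comment> \<open>Young's inequality, weighted so that half of the left-hand side returns and can
    be absorbed; doubling the remaining \<open>2 * R\<^sup>2\<close> gives the constant
    \<open>4 * R\<^sup>2\<close>.\<close>
  also have "\<dots> \<le> (LINT x|lebesgue_on U. (1/2) * (\<phi> x * \<phi> x)
      + 2 * R\<^sup>2 * (classical_gradient \<phi> x \<bullet> classical_gradient \<phi> x))"
  proof (rule integral_mono)
    fix x assume "x \<in> space (lebesgue_on U)"
    then have "norm x \<le> R" using assms(2) by auto
    then have "\<bar>x \<bullet> b\<bar> \<le> R" using Basis_le_norm[OF b, of x] by linarith
    moreover have "\<bar>?D x\<bar> \<le> norm (classical_gradient \<phi> x)"
      using Basis_le_norm[OF b, of "classical_gradient \<phi> x"] b by simp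
    ultimately have "\<bar>x \<bullet> b\<bar> * \<bar>?D x\<bar> \<le> R * norm (classical_gradient \<phi> x)"
      by (intro mult_mono) auto
    then have "(\<bar>x \<bullet> b\<bar> * \<bar>?D x\<bar>)\<^sup>2 \<le> (R * norm (classical_gradient \<phi> x))\<^sup>2"
      by (intro power_mono) auto
    then have "((x \<bullet> b) * ?D x)\<^sup>2 \<le> R\<^sup>2 * (classical_gradient \<phi> x \<bullet> classical_gradient \<phi> x)"
      by (simp add: power_mult_distrib power2_norm_eq_inner)
    moreover have "- 2 * (\<phi> x * (x \<bullet> b) * ?D x) \<le> (1/2) * (\<phi> x * \<phi> x) + 2 * ((x \<bullet> b) * ?D x)\<^sup>2"
      using zero_le_power2[of "\<phi> x + 2 * ((x \<bullet> b) * ?D x)"]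
      by (simp add: power2_eq_square algebra_simps)
    ultimately show "- 2 * (\<phi> x * (x \<bullet> b) * ?D x)
        \<le> (1/2) * (\<phi> x * \<phi> x) + 2 * R\<^sup>2 * (classical_gradient \<phi> x \<bullet> classical_gradient \<phi> x)"
      by linarith
  qed (use i1 i2 i3 in auto)
  also have "\<dots> = (1/2) * (LINT x|lebesgue_on U. \<phi> x * \<phi> x)
      + 2 * R\<^sup>2 * (LINT x|lebesgue_on U. classical_gradient \<phi> x \<bullet> classical_gradient \<phi> x)"
    using i2 i3 by simp
  finally show ?thesis by (simp add: l2_inner_def)
qed

text \<open>The Riesz argument asks for definiteness and not for coercivity, so the Poincare
  inequality is carried to the limit only for vanishing gradients. Then the gradient of \<phi> k is
  minus that of the error v - \<phi> k, so \<phi> k is controlled by the error and \<open>v\<close>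
  by both.\<close>

lemma H1_0_grad_zero:
  assumes v: "v \<in> H1_0 U" and zero: "l2_inner U (grad U v) (grad U v) = 0"
  shows "l2_inner U v v = 0"
proof -
  obtain \<phi> where \<phi>: "\<And>k::nat. \<phi> k \<in> test_functions U" "(\<lambda>k. h1_norm U (\<lambda>x. v x - \<phi> k x)) \<longlonglongrightarrow> 0"
    using v unfolding H1_0_def by blast
  have H1: "v \<in> H1 U" and L2: "v \<in> L2 U" using v by (auto simp: H1_0_def H1_def)
  obtain R where R: "U \<subseteq> cball 0 R"
    using U(2) unfolding bounded_iff by (metis mem_cball_0 subsetI)
  \<comment> \<open>With e the error norm, Poincare gives \<open>8 * R\<^sup>2\<close> times e^2 for
    \<phi> k. Splitting v into error and \<phi> k doubles both contributions: 2 + 2 * 8 R^2.\<close>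
  have le: "l2_inner U v v \<le> (2 + 16 * R\<^sup>2) * (h1_norm U (\<lambda>x. v x - \<phi> k x))\<^sup>2" for k
  proof -
    let ?d = "\<lambda>x. v x - \<phi> k x"
    note \<phi>k = test_function_H1[OF \<phi>(1)[of k]]
    have d: "?d \<in> H1 U" "AE x in lebesgue_on U. grad U ?d x = grad U v x - grad U (\<phi> k) x"
      using H1_add_scale[OF H1 \<phi>k(1), of "-1"] by simp_all
    note dG = grad_of_H1(1)[OF d(1)] and vG = grad_of_H1(1)[OF H1]
    have dL2: "?d \<in> L2 U" using d(1) by (simp add: H1_def)
    have "AE x in lebesgue_on U. classical_gradient (\<phi> k) x = grad U v x + (-1) *\<^sub>R grad U ?d x"
      using d(2) \<phi>k(2) by eventually_elim simp
    then have "l2_inner U (classical_gradient (\<phi> k)) (classical_gradient (\<phi> k))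
        = l2_inner U (\<lambda>x. grad U v x + (-1) *\<^sub>R grad U ?d x) (\<lambda>x. grad U v x + (-1) *\<^sub>R grad U ?d x)"
      using \<phi>k(3) L2_add_scaleR[OF vG dG, of "-1"] by (intro l2_inner_cong_AE)
    also have "\<dots> \<le> 2 * l2_inner U (grad U ?d) (grad U ?d)"
      using l2_inner_add_scaleR_self_le[OF vG dG, of "-1"] zero by simp
    also have "\<dots> \<le> 2 * (h1_norm U ?d)\<^sup>2"
      using l2_inner_nonneg[of U ?d] by (simp add: h1_norm_power2)
    finally have "4 * R\<^sup>2 * l2_inner U (classical_gradient (\<phi> k)) (classical_gradient (\<phi> k))
        \<le> 4 * R\<^sup>2 * (2 * (h1_norm U ?d)\<^sup>2)"
      by (intro mult_left_mono) auto
    with Poincare_test_function[OF \<phi>(1) R, of k]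
    have "l2_inner U (\<phi> k) (\<phi> k) \<le> 8 * R\<^sup>2 * (h1_norm U ?d)\<^sup>2" by linarith
    moreover have "l2_inner U v v \<le> 2 * l2_inner U ?d ?d + 2 * l2_inner U (\<phi> k) (\<phi> k)"
      using l2_inner_add_scaleR_self_le[OF dL2 test_function_L2(1)[OF \<phi>(1)[of k]], of 1] by simp
    moreover have "l2_inner U ?d ?d \<le> (h1_norm U ?d)\<^sup>2"
      using l2_inner_nonneg[of U "grad U ?d"] by (simp add: h1_norm_power2)
    ultimately show ?thesis by (simp add: distrib_right)
  qed
  have "(\<lambda>k. (2 + 16 * R\<^sup>2) * (h1_norm U (\<lambda>x. v x - \<phi> k x))\<^sup>2) \<longlonglongrightarrow> (2 + 16 * R\<^sup>2) * 0\<^sup>2"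
    by (intro tendsto_intros \<phi>)
  then have "l2_inner U v v \<le> 0"
    using le by (intro LIMSEQ_le_const) auto
  with l2_inner_nonneg[of U v] show ?thesis by simp
qed

end

section \<open>The discrete spaces\<close>

text \<open>A finite-dimensional Riesz representation for a form that is definite only up to a null space,
  on which \<open>F\<close> vanishes.  Finite dimension enters through finitely many functionals
  \<open>L i\<close> that separate points modulo that null space.  They are removed one at a time: the kernel
  of \<open>L i\<close> has codimension at most one, and its orthogonal complement is spanned by \<open>z\<close>.\<close>
lemma semidefinite_Riesz_representation:
  fixes W :: "('b \<Rightarrow> real) set" and B :: "('b \<Rightarrow> real) \<Rightarrow> ('b \<Rightarrow> real) \<Rightarrow> real"
    and L :: "'i \<Rightarrow> ('b \<Rightarrow> real) \<Rightarrow> real"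
  assumes "finite I"
    and "(\<lambda>x. 0) \<in> W" "\<And>v w c. v \<in> W \<Longrightarrow> w \<in> W \<Longrightarrow> (\<lambda>x. v x + c * w x) \<in> W"
    and "\<And>u v w c. u \<in> W \<Longrightarrow> v \<in> W \<Longrightarrow> w \<in> W \<Longrightarrow> B u (\<lambda>x. v x + c * w x) = B u v + c * B u w"
    and "\<And>v w. B v w = B w v"
    and "\<And>w z. w \<in> W \<Longrightarrow> z \<in> W \<Longrightarrow> B w w = 0 \<Longrightarrow> B z w = 0"
    and "\<And>v w c. v \<in> W \<Longrightarrow> w \<in> W \<Longrightarrow> F (\<lambda>x. v x + c * w x) = F v + c * F w"
    and "\<And>w. w \<in> W \<Longrightarrow> B w w = 0 \<Longrightarrow> F w = 0"
    and "\<And>i v w c. v \<in> W \<Longrightarrow> w \<in> W \<Longrightarrow> i \<in> I \<Longrightarrow> L i (\<lambda>x. v x + c * w x) = L i v + c * L i w"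
    and "\<And>w. w \<in> W \<Longrightarrow> (\<And>i. i \<in> I \<Longrightarrow> L i w = 0) \<Longrightarrow> B w w = 0"
  shows "\<exists>w\<in>W. \<forall>\<eta>\<in>W. B w \<eta> = F \<eta>"
  using assms
proof (induction I arbitrary: W F rule: finite_induct)
  case empty
  \<comment> \<open>Without functionals, separation makes every element null for \<open>B\<close>,
    so both sides are 0.\<close>
  then have "B (\<lambda>x. 0) \<eta> = F \<eta>" if "\<eta> \<in> W" for \<eta>
    using that by (metis empty_iff)
  then show ?case using empty.prems(1) by blast
next
  case (insert i I)
  note zero = insert.prems(1) and lin = insert.prems(2) and B_lin = insert.prems(3)
    and sym = insert.prems(4) and B_null = insert.prems(5) and F_lin = insert.prems(6)
    and F_null = insert.prems(7) and L_lin = insert.prems(8) and sep = insert.prems(9)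
  define W' where "W' = {w \<in> W. L i w = 0}"
  have W'W: "w \<in> W" if "w \<in> W'" for w using that by (simp add: W'_def)
  have L0: "L i (\<lambda>x. 0) = 0"
    using L_lin[OF zero zero, of i "-1"] by simp
  \<comment> \<open>The induction hypothesis on the kernel serves two functionals: \<open>F\<close>
    itself and \<open>B z0\<close>, whose representative projects \<open>z0\<close> onto the
    kernel.\<close>
  have rep: "\<exists>w\<in>W'. \<forall>\<eta>\<in>W'. B w \<eta> = G \<eta>"
    if "\<And>v w c. v \<in> W \<Longrightarrow> w \<in> W \<Longrightarrow> G (\<lambda>x. v x + c * w x) = G v + c * G w"
      "\<And>w. w \<in> W \<Longrightarrow> B w w = 0 \<Longrightarrow> G w = 0" for G
  proof (rule insert.IH)
    show "B w w = 0" if "w \<in> W'" "\<And>j. j \<in> I \<Longrightarrow> L j w = 0" for w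
      using that by (intro sep) (auto simp: W'_def)
  qed (use zero lin L0 B_lin sym B_null L_lin that in \<open>auto simp: W'_def\<close>)
  show ?case
  proof (cases "W' = W")
    case True
    then show ?thesis using rep[of F] F_lin F_null by simp
  next
    case False
    then obtain z0 where z0: "z0 \<in> W" "L i z0 \<noteq> 0" by (auto simp: W'_def)
    obtain r where r: "r \<in> W'" "\<And>\<eta>. \<eta> \<in> W' \<Longrightarrow> B r \<eta> = B z0 \<eta>"
      using rep[of "B z0"] B_lin[OF z0(1)] B_null[OF _ z0(1)] by auto
    \<comment> \<open>Removing the projection makes \<open>z\<close> orthogonal to \<open>W'\<close>
      and leaves \<open>L i z = L i z0\<close>, which is nonzero.\<close>
    define z where "z = (\<lambda>x. z0 x + (-1) * r x)"
    have z: "z \<in> W" unfolding z_def using z0 r W'W by (intro lin)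
    have Lz: "L i z \<noteq> 0"
      unfolding z_def L_lin[OF z0(1) W'W[OF r(1)] insertI1] using z0 r(1) by (simp add: W'_def)
    have z_orth: "B \<eta> z = 0" if "\<eta> \<in> W'" for \<eta>
      unfolding z_def B_lin[OF W'W[OF that] z0(1) W'W[OF r(1)]]
      using r(2)[OF that] sym[of \<eta>] by simp
    obtain w' where w': "w' \<in> W'" "\<And>\<eta>. \<eta> \<in> W' \<Longrightarrow> B w' \<eta> = F \<eta>"
      using rep[of F] F_lin F_null by auto
    \<comment> \<open>The multiple of \<open>z\<close> that gives the right value on
      \<open>z\<close>. If \<open>B z z = 0\<close>, then \<open>F z = 0\<close> as well and any
      value of \<open>s\<close> would do.\<close>
    define s where "s = F z / B z z"
    define w where "w = (\<lambda>x. w' x + s * z x)"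
    have w: "w \<in> W" unfolding w_def using z w' W'W by (intro lin)
    have Bzw: "B z w = F z"
      unfolding w_def B_lin[OF z W'W[OF w'(1)] z]
      using z_orth[OF w'(1)] F_null[OF z] sym[of z w'] by (cases "B z z = 0") (auto simp: s_def)
    have "B w \<eta> = F \<eta>" if \<eta>: "\<eta> \<in> W" for \<eta>
    proof -
      \<comment> \<open>Chosen so that subtracting \<open>t\<close> times \<open>z\<close> from
        \<eta> lands in the kernel of \<open>L i\<close>.\<close>
      define t where "t = L i \<eta> / L i z"
      define \<eta>' where "\<eta>' = (\<lambda>x. \<eta> x + (- t) * z x)"
      have \<eta>'W: "\<eta>' \<in> W" unfolding \<eta>'_def by (intro lin \<eta> z)
      have \<eta>': "\<eta>' \<in> W'"
        using \<eta>'W L_lin[OF \<eta> z insertI1, of "- t"] Lz by (simp add: W'_def \<eta>'_def t_def)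
      have dec: "\<eta> = (\<lambda>x. \<eta>' x + t * z x)" by (simp add: \<eta>'_def)
      have "B w \<eta>' = B \<eta>' w' + s * B \<eta>' z"
        unfolding sym[of w] unfolding w_def by (rule B_lin[OF \<eta>'W W'W[OF w'(1)] z])
      also have "\<dots> = F \<eta>'" using z_orth[OF \<eta>'] w'(2)[OF \<eta>'] sym[of \<eta>'] by simp
      finally have "B w \<eta>' + t * B w z = F \<eta>' + t * F z"
        using Bzw sym[of w z] by simp
      then show ?thesis
        using B_lin[OF w \<eta>'W z, of t] F_lin[OF \<eta>'W z, of t] dec by simp
    qed
    with w show ?thesis by blast
  qed
qed

section \<open>Piecewise polynomials, their moments and their elementwise gradients\<close>

lemma polynomial_fun_add_scale:
  assumes "polynomial_fun l p" "polynomial_fun l q"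
  shows "polynomial_fun l (\<lambda>x. p x + c * q x)"
proof -
  let ?A = "{\<alpha> \<in> Basis \<rightarrow>\<^sub>E UNIV. (\<Sum>b\<in>Basis. \<alpha> b) \<le> l}"
  obtain d e where "\<And>x. p x = (\<Sum>\<alpha>\<in>?A. d \<alpha> * (\<Prod>b\<in>Basis. (x \<bullet> b) ^ \<alpha> b))"
    "\<And>x. q x = (\<Sum>\<alpha>\<in>?A. e \<alpha> * (\<Prod>b\<in>Basis. (x \<bullet> b) ^ \<alpha> b))"
    using assms unfolding polynomial_fun_def by blast
  then have "p x + c * q x = (\<Sum>\<alpha>\<in>?A. (d \<alpha> + c * e \<alpha>) * (\<Prod>b\<in>Basis. (x \<bullet> b) ^ \<alpha> b))" for x
    by (simp add: sum_distrib_left sum.distrib[symmetric] algebra_simps)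
  then show ?thesis unfolding polynomial_fun_def by (intro exI[of _ "\<lambda>\<alpha>. d \<alpha> + c * e \<alpha>"]) simp
qed

lemma piecewise_polynomial_add_scale:
  assumes "piecewise_polynomial \<T> l v" "piecewise_polynomial \<T> l w"
  shows "piecewise_polynomial \<T> l (\<lambda>x. v x + c * w x)"
  unfolding piecewise_polynomial_def
proof
  fix K assume "K \<in> \<T>"
  then obtain p q where "polynomial_fun l p" "\<forall>x\<in>interior K. v x = p x"
    "polynomial_fun l q" "\<forall>x\<in>interior K. w x = q x"
    using assms unfolding piecewise_polynomial_def by meson
  then show "\<exists>p. polynomial_fun l p \<and> (\<forall>x\<in>interior K. v x + c * w x = p x)"
    using polynomial_fun_add_scale by (intro exI[of _ "\<lambda>x. p x + c * q x"]) auto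
qed

lemma L2_cong:
  assumes "\<And>x. x \<in> U \<Longrightarrow> v x = w x" "w \<in> L2 U"
  shows "v \<in> L2 U"
proof -
  have "v \<in> borel_measurable (lebesgue_on U) \<longleftrightarrow> w \<in> borel_measurable (lebesgue_on U)"
    by (rule measurable_cong) (use assms(1) in simp)
  moreover have "integrable (lebesgue_on U) (\<lambda>x. (norm (v x))\<^sup>2)
      \<longleftrightarrow> integrable (lebesgue_on U) (\<lambda>x. (norm (w x))\<^sup>2)"
    by (rule Bochner_Integration.integrable_cong) (use assms(1) in auto)
  ultimately show ?thesis using assms(2) by (simp add: L2_def)
qed

lemma zero_L2: "(\<lambda>x. 0) \<in> L2 U"
  by (simp add: L2_def)

lemma has_weak_gradient_zero: "has_weak_gradient U (\<lambda>x. 0) (\<lambda>x. 0)"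
  by (simp add: has_weak_gradient_def)

text \<open>Serves the summands of \<open>grad_h\<close>: gradients on the interior of one element,
  cut off by an indicator and viewed on the whole domain.\<close>

lemma L2_zero_extension:
  fixes G :: "'a::euclidean_space \<Rightarrow> 'b::euclidean_space"
  assumes "G \<in> L2 K" "K \<in> sets lebesgue" "U \<in> sets lebesgue"
  shows "(\<lambda>x. indicator K x *\<^sub>R G x) \<in> L2 U"
proof -
  have G: "G \<in> borel_measurable (lebesgue_on K)" "integrable (lebesgue_on K) (\<lambda>x. (norm (G x))\<^sup>2)"
    using assms(1) by (auto simp: L2_def)
  have m: "(\<lambda>x. indicator K x *\<^sub>R G x) \<in> borel_measurable lebesgue"
    using G(1) assms(2) by (simp add: borel_measurable_restrict_space_iff)
  have "integrable lebesgue (\<lambda>x. indicator K x *\<^sub>R (norm (G x))\<^sup>2)"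
    using G(2) assms(2) by (simp add: integrable_restrict_space)
  also have "(\<lambda>x. indicator K x *\<^sub>R (norm (G x))\<^sup>2) = (\<lambda>x. (norm (indicator K x *\<^sub>R G x))\<^sup>2)"
    by (auto simp: indicator_def)
  finally have "integrable lebesgue (\<lambda>x. indicator U x *\<^sub>R (norm (indicator K x *\<^sub>R G x))\<^sup>2)"
    using assms(3) by (intro integrable_mult_indicator) auto
  then have "integrable (lebesgue_on U) (\<lambda>x. (norm (indicator K x *\<^sub>R G x))\<^sup>2)"
    using assms(3) by (simp add: integrable_restrict_space)
  with measurable_restrict_space1[OF m, of U] show ?thesis
    by (simp add: L2_def)
qed

lemma finite_multi_indices:
  "finite {\<alpha> \<in> Basis \<rightarrow>\<^sub>E (UNIV :: nat set). (\<Sum>b\<in>(Basis :: 'a::euclidean_space set). \<alpha> b) \<le> l}"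
proof (rule finite_subset)
  show "finite ((Basis :: 'a set) \<rightarrow>\<^sub>E {..l})" by (intro finite_PiE) auto
  show "{\<alpha> \<in> Basis \<rightarrow>\<^sub>E (UNIV :: nat set). (\<Sum>b\<in>(Basis :: 'a set). \<alpha> b) \<le> l} \<subseteq> Basis \<rightarrow>\<^sub>E {..l}"
  proof
    fix \<alpha> assume \<alpha>: "\<alpha> \<in> {\<alpha> \<in> Basis \<rightarrow>\<^sub>E (UNIV :: nat set). (\<Sum>b\<in>(Basis :: 'a set). \<alpha> b) \<le> l}"
    have "\<alpha> b \<le> l" if "b \<in> Basis" for b
      using \<alpha> member_le_sum[of b Basis \<alpha>] that by auto
    with \<alpha> show "\<alpha> \<in> Basis \<rightarrow>\<^sub>E {..l}" by (auto simp: PiE_iff)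
  qed
qed

definition monomial_fun :: "('a::euclidean_space \<Rightarrow> nat) \<Rightarrow> 'a \<Rightarrow> real" where
  "monomial_fun \<alpha> x = (\<Prod>b\<in>Basis. (x \<bullet> b) ^ \<alpha> b)"

lemma monomial_fun_L2:
  assumes "U \<in> lmeasurable" "bounded U"
  shows "monomial_fun \<alpha> \<in> L2 U"
  unfolding monomial_fun_def[abs_def] by (intro continuous_L2 assms continuous_intros)

text \<open>Expanding one factor of \<open>l2_inner U v v\<close> into monomials turns it into a
  combination of the moments of \<open>v\<close>. This is what makes moments separate functions up
  to null functions.\<close>

lemma polynomial_moments_zero:
  assumes "open U" "bounded U" "polynomial_fun l p" "\<And>x. x \<in> U \<Longrightarrow> v x = p x"
    and zero: "\<And>\<alpha>. \<alpha> \<in> Basis \<rightarrow>\<^sub>E UNIV \<Longrightarrow> (\<Sum>b\<in>Basis. \<alpha> b) \<le> l \<Longrightarrow> l2_inner U v (monomial_fun \<alpha>) = 0"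
  shows "AE x in lebesgue_on U. v x = 0"
proof -
  let ?A = "{\<alpha> \<in> Basis \<rightarrow>\<^sub>E UNIV. (\<Sum>b\<in>Basis. \<alpha> b) \<le> l}"
  have U: "U \<in> lmeasurable" using lmeasurable_open assms(1,2) by blast
  obtain c where c: "\<And>x. p x = (\<Sum>\<alpha>\<in>?A. c \<alpha> * monomial_fun \<alpha> x)"
    using assms(3) unfolding polynomial_fun_def monomial_fun_def by blast
  have "p \<in> L2 U"
    using polynomial_fun_C_k[OF assms(3), of 0] by (intro continuous_L2 U assms) simp
  then have v: "v \<in> L2 U" using L2_cong assms(4) by blast
  have "l2_inner U v v = (LINT x|lebesgue_on U. (\<Sum>\<alpha>\<in>?A. c \<alpha> * (v x \<bullet> monomial_fun \<alpha> x)))"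
    unfolding l2_inner_def
    by (rule Bochner_Integration.integral_cong)
       (auto simp: assms(4) c sum_distrib_left mult_ac)
  also have "\<dots> = (\<Sum>\<alpha>\<in>?A. c \<alpha> * l2_inner U v (monomial_fun \<alpha>))"
    unfolding l2_inner_def using L2_inner_integrable[OF v monomial_fun_L2[OF U assms(2)]]
    by (subst Bochner_Integration.integral_sum) (auto simp del: inner_real_def)
  also have "\<dots> = 0" using zero by (intro sum.neutral) auto
  finally show ?thesis using l2_inner_self_eq_0[OF v] by simp
qed

lemma triangulation_interiors:
  fixes \<Omega> :: "'a::euclidean_space set"
  assumes "open \<Omega>" "simplicial_triangulation \<Omega> \<T>"
  shows "finite \<T>" "K \<in> \<T> \<Longrightarrow> bounded (interior K)"
    "AE x in lebesgue_on \<Omega>. \<exists>K\<in>\<T>. x \<in> interior K"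
proof -
  show fin: "finite \<T>" using assms(2) by (auto simp: simplicial_triangulation_def triangulation_def)
  have simp: "compact K" "convex K" if "K \<in> \<T>" for K
    using that assms(2) simplex_imp_polytope polytope_imp_compact polytope_imp_convex
    unfolding simplicial_triangulation_def by blast+
  have Un: "\<Union>\<T> = closure \<Omega>" using assms(2) by (simp add: simplicial_triangulation_def)
  show "bounded (interior K)" if "K \<in> \<T>"
    using simp(1)[OF that] compact_imp_bounded bounded_interior by blast
  \<comment> \<open>Elements are convex, so their frontiers are null sets, and there are finitely
    many of them.\<close>
  have "negligible (\<Union>(frontier ` \<T>))"
    using fin simp by (intro negligible_Union) (auto intro: negligible_convex_frontier)
  then have skeleton: "AE x in lebesgue. x \<notin> \<Union>(frontier ` \<T>)"
    unfolding negligible_iff_null_sets by (rule AE_not_in)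
  have interior: "\<exists>K\<in>\<T>. x \<in> interior K" if x: "x \<in> \<Omega>" "x \<notin> \<Union>(frontier ` \<T>)" for x
  proof -
    obtain K where K: "K \<in> \<T>" "x \<in> K" using x(1) Un closure_subset by blast
    then have "x \<in> interior K" using x(2) closure_subset[of K] by (auto simp: frontier_def)
    with K show ?thesis by blast
  qed
  have "AE x in lebesgue. x \<in> \<Omega> \<longrightarrow> (\<exists>K\<in>\<T>. x \<in> interior K)"
    using skeleton by (rule eventually_mono) (use interior in blast)
  then show "AE x in lebesgue_on \<Omega>. \<exists>K\<in>\<T>. x \<in> interior K"
    using assms(1) by (subst AE_restrict_space_iff) auto
qed

lemma piecewise_polynomial_moments_zero:
  assumes \<Omega>: "open \<Omega>" "simplicial_triangulation \<Omega> \<T>" and v: "piecewise_polynomial \<T> l v"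
    and zero: "\<And>K \<alpha>. K \<in> \<T> \<Longrightarrow> \<alpha> \<in> Basis \<rightarrow>\<^sub>E UNIV \<Longrightarrow> (\<Sum>b\<in>Basis. \<alpha> b) \<le> l \<Longrightarrow>
      l2_inner (interior K) v (monomial_fun \<alpha>) = 0"
  shows "AE x in lebesgue_on \<Omega>. v x = 0"
proof -
  note T = triangulation_interiors[OF \<Omega>]
  have "AE x in lebesgue. x \<in> interior K \<longrightarrow> v x = 0" if K: "K \<in> \<T>" for K
  proof -
    obtain p where "polynomial_fun l p" "\<And>x. x \<in> interior K \<Longrightarrow> v x = p x"
      using v K unfolding piecewise_polynomial_def by blast
    then have "AE x in lebesgue_on (interior K). v x = 0"
      using zero[OF K] T(2)[OF K] by (intro polynomial_moments_zero[of "interior K" l p]) auto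
    then show ?thesis by (subst (asm) AE_restrict_space_iff) auto
  qed
  then have "AE x in lebesgue. \<forall>K\<in>\<T>. x \<in> interior K \<longrightarrow> v x = 0"
    by (subst AE_ball_countable) (simp_all add: countable_finite T(1))
  moreover have "AE x in lebesgue. x \<in> \<Omega> \<longrightarrow> (\<exists>K\<in>\<T>. x \<in> interior K)"
    using T(3) \<Omega>(1) by (subst (asm) AE_restrict_space_iff) auto
  ultimately have "AE x in lebesgue. x \<in> \<Omega> \<longrightarrow> v x = 0"
    by eventually_elim auto
  then show ?thesis using \<Omega>(1) by (subst AE_restrict_space_iff) auto
qed

text \<open>Membership in \<open>H1\<close> of each element interior comes first, since otherwise
  the choice in \<open>grad\<close> could be any function. It holds because \<open>v\<close> agrees
  there with a polynomial, whose classical gradient is a weak gradient.\<close>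

lemma grad_h_L2:
  assumes \<Omega>: "open \<Omega>" "simplicial_triangulation \<Omega> \<T>" and v: "piecewise_polynomial \<T> l v"
  shows "grad_h \<T> v \<in> L2 \<Omega>"
proof -
  note T = triangulation_interiors[OF \<Omega>]
  have piece: "(\<lambda>x. indicator (interior K) x *\<^sub>R grad (interior K) v x) \<in> L2 \<Omega>" if K: "K \<in> \<T>" for K
  proof -
    obtain p where p: "polynomial_fun l p" "\<And>x. x \<in> interior K \<Longrightarrow> v x = p x"
      using v K unfolding piecewise_polynomial_def by blast
    note C1 = C1_in_H1[OF open_interior T(2)[OF K] polynomial_fun_C_k[OF p(1)]]
    have "p \<in> L2 (interior K)" using C1(1) by (simp add: H1_def)
    then have "v \<in> L2 (interior K)" using L2_cong p(2) by blast
    moreover have "has_weak_gradient (interior K) v (classical_gradient p)"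
      using has_weak_gradient_cong[OF p(2) has_weak_gradient_classical[OF polynomial_fun_C_k[OF p(1)]]]
      by simp
    ultimately have "v \<in> H1 (interior K)" using C1(3) unfolding H1_def by blast
    then show ?thesis using \<Omega>(1) by (intro L2_zero_extension grad_of_H1(1)) auto
  qed
  have "(\<lambda>x. \<Sum>K\<in>\<S>. indicator (interior K) x *\<^sub>R grad (interior K) v x) \<in> L2 \<Omega>" if "\<S> \<subseteq> \<T>" for \<S>
    using finite_subset[OF that T(1)] that
  proof (induction \<S> rule: finite_induct)
    case empty
    show ?case by (simp add: zero_L2)
  next
    case (insert K \<S>)
    then have "(\<lambda>x. indicator (interior K) x *\<^sub>R grad (interior K) v x
        + 1 *\<^sub>R (\<Sum>K\<in>\<S>. indicator (interior K) x *\<^sub>R grad (interior K) v x)) \<in> L2 \<Omega>"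
      by (intro L2_add_scaleR piece) auto
    then show ?case
      by (simp only: sum.insert[OF insert.hyps] scaleR_one)
  qed
  then show ?thesis unfolding grad_h_def[abs_def] by blast
qed


section \<open>The space \<open>W_h\<close>, the projection \<open>P_h\<close> and the discrete
  Poisson problem\<close>

context
  fixes \<Omega> :: "'a::euclidean_space set" and \<T> :: "'a set set" and l :: nat
  assumes \<Omega>: "open \<Omega>" "bounded \<Omega>" and \<T>: "simplicial_triangulation \<Omega> \<T>"
begin

lemma W_h_H1:
  assumes "w \<in> W_h \<Omega> \<T> l"
  shows "w \<in> H1 \<Omega>" "w \<in> L2 \<Omega>" "grad \<Omega> w \<in> L2 \<Omega>"
proof -
  show H1: "w \<in> H1 \<Omega>" using assms by (simp add: W_h_def H1_0_def)
  then show "w \<in> L2 \<Omega>" by (simp add: H1_def)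
  show "grad \<Omega> w \<in> L2 \<Omega>" by (rule grad_of_H1(1)[OF H1])
qed

lemma W_h_add_scale:
  "v \<in> W_h \<Omega> \<T> l \<Longrightarrow> w \<in> W_h \<Omega> \<T> l \<Longrightarrow> (\<lambda>x. v x + c * w x) \<in> W_h \<Omega> \<T> l"
  unfolding W_h_def using H1_0_add_scale[OF \<Omega>(1,2)] piecewise_polynomial_add_scale by blast

text \<open>Even the gradient of the zero function is a chosen representative; that its norm is 0
  rests on uniqueness of weak gradients.\<close>

lemma zero_in_W_h: "(\<lambda>x. 0) \<in> W_h \<Omega> \<T> l"
proof -
  have H1: "(\<lambda>x. 0) \<in> H1 \<Omega>"
    using zero_L2 bexI[of "has_weak_gradient \<Omega> (\<lambda>x. 0)", OF has_weak_gradient_zero zero_L2]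
    by (simp add: H1_def)
  have "AE x in lebesgue_on \<Omega>. grad \<Omega> (\<lambda>x. 0) x = 0"
    by (rule has_weak_gradient_unique[OF \<Omega>(1,2) zero_L2 zero_L2 _
          grad_of_H1[OF H1] zero_L2 has_weak_gradient_zero]) simp
  then have "h1_norm \<Omega> (\<lambda>x. 0) = 0"
    using l2_inner_self_eq_0[OF grad_of_H1(1)[OF H1]] by (simp add: h1_norm_def l2_inner_def)
  with H1 have "(\<lambda>x. 0) \<in> H1_0 \<Omega>"
    using zero_test_function unfolding H1_0_def by (auto intro!: exI[of _ "\<lambda>k x. 0"])
  moreover have "polynomial_fun l (\<lambda>x :: 'a. 0)"
    unfolding polynomial_fun_def by (intro exI[of _ "\<lambda>_. 0"]) simp
  ultimately show ?thesis unfolding W_h_def piecewise_polynomial_def by blast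
qed

lemma l2_inner_grad_add_scale:
  assumes "G \<in> L2 \<Omega>" "v \<in> W_h \<Omega> \<T> l" "w \<in> W_h \<Omega> \<T> l"
  shows "l2_inner \<Omega> G (grad \<Omega> (\<lambda>x. v x + c * w x))
    = l2_inner \<Omega> G (grad \<Omega> v) + c * l2_inner \<Omega> G (grad \<Omega> w)"
proof -
  note v = W_h_H1[OF assms(2)] and w = W_h_H1[OF assms(3)]
  have "l2_inner \<Omega> G (grad \<Omega> (\<lambda>x. v x + c * w x))
      = l2_inner \<Omega> G (\<lambda>x. grad \<Omega> v x + c *\<^sub>R grad \<Omega> w x)"
    using H1_add_scale(2)[OF \<Omega>(1,2) v(1) w(1)] assms(1) W_h_H1(3)[OF W_h_add_scale[OF assms(2,3)]]
    by (intro l2_inner_cong_AE L2_add_scaleR v w) auto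
  then show ?thesis by (simp add: l2_inner_add_scaleR_right assms v w)
qed

lemma l2_inner_AE_zero:
  assumes "AE x in lebesgue_on \<Omega>. w x = 0"
  shows "l2_inner \<Omega> G w = 0"
proof -
  have "AE x in lebesgue_on \<Omega>. G x \<bullet> w x = 0"
    using assms by eventually_elim simp
  then show ?thesis unfolding l2_inner_def by (rule integral_eq_zero_AE)
qed

text \<open>One direction is uniqueness of weak gradients, the other the Poincare inequality.
  Together they identify the null space of the form with the null functions, on which every load
  given by an \<open>L2\<close> product vanishes.\<close>

lemma W_h_AE_zero_iff_grad:
  assumes "w \<in> W_h \<Omega> \<T> l"
  shows "(AE x in lebesgue_on \<Omega>. w x = 0) \<longleftrightarrow> (AE x in lebesgue_on \<Omega>. grad \<Omega> w x = 0)"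
proof
  note w = W_h_H1[OF assms]
  assume "AE x in lebesgue_on \<Omega>. w x = 0"
  then show "AE x in lebesgue_on \<Omega>. grad \<Omega> w x = 0"
    by (rule has_weak_gradient_unique[OF \<Omega>(1,2) w(2) zero_L2 _
          grad_of_H1[OF w(1)] zero_L2 has_weak_gradient_zero])
next
  note w = W_h_H1[OF assms]
  assume "AE x in lebesgue_on \<Omega>. grad \<Omega> w x = 0"
  then have "l2_inner \<Omega> w w = 0"
    using H1_0_grad_zero[OF \<Omega>(1,2)] assms l2_inner_AE_zero by (auto simp: W_h_def)
  then show "AE x in lebesgue_on \<Omega>. w x = 0" using l2_inner_self_eq_0[OF w(2)] by simp
qed

text \<open>The separating functionals are the moments on single elements, indexed by an element and
  a multi-index of degree at most \<open>l\<close>; there are finitely many of both. Both the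
  Poisson load and the load defining \<open>P_h\<close> are instances of \<open>F\<close>.\<close>

lemma W_h_Riesz_representation:
  assumes F: "\<And>v w c. v \<in> W_h \<Omega> \<T> l \<Longrightarrow> w \<in> W_h \<Omega> \<T> l \<Longrightarrow> F (\<lambda>x. v x + c * w x) = F v + c * F w"
    and F_null: "\<And>w. w \<in> W_h \<Omega> \<T> l \<Longrightarrow> AE x in lebesgue_on \<Omega>. w x = 0 \<Longrightarrow> F w = 0"
  shows "\<exists>w\<in>W_h \<Omega> \<T> l. \<forall>\<eta>\<in>W_h \<Omega> \<T> l. l2_inner \<Omega> (grad \<Omega> w) (grad \<Omega> \<eta>) = F \<eta>"
proof -
  note T = triangulation_interiors[OF \<Omega>(1) \<T>]
  let ?W = "W_h \<Omega> \<T> l" and ?B = "\<lambda>v w. l2_inner \<Omega> (grad \<Omega> v) (grad \<Omega> w)"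
  define A where "A = {\<alpha> \<in> Basis \<rightarrow>\<^sub>E (UNIV :: nat set). (\<Sum>b\<in>(Basis :: 'a set). \<alpha> b) \<le> l}"
  define L where "L i v = l2_inner (interior (fst i)) v (monomial_fun (snd i))"
    for i :: "'a set \<times> ('a \<Rightarrow> nat)" and v
  have null: "?B w w = 0 \<longleftrightarrow> (AE x in lebesgue_on \<Omega>. w x = 0)" if "w \<in> ?W" for w
    using l2_inner_self_eq_0[OF W_h_H1(3)[OF that]] W_h_AE_zero_iff_grad[OF that] by simp
  show ?thesis
  proof (rule semidefinite_Riesz_representation[where B="?B" and L=L])
    show "finite (\<T> \<times> A)" using T(1) finite_multi_indices by (auto simp: A_def)
    show "?B u (\<lambda>x. v x + c * w x) = ?B u v + c * ?B u w" if "u \<in> ?W" "v \<in> ?W" "w \<in> ?W" for u v w c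
      by (rule l2_inner_grad_add_scale[OF W_h_H1(3)[OF that(1)] that(2,3)])
    show "?B z w = 0" if "w \<in> ?W" "z \<in> ?W" "?B w w = 0" for w z
      using that null W_h_AE_zero_iff_grad l2_inner_AE_zero by blast
    show "L i (\<lambda>x. v x + c * w x) = L i v + c * L i w" if "v \<in> ?W" "w \<in> ?W" "i \<in> \<T> \<times> A" for i v w c
    proof -
      have K: "fst i \<in> \<T>" using that(3) by auto
      have "u \<in> L2 (interior (fst i))" if u: "u \<in> ?W" for u
      proof -
        obtain p where p: "polynomial_fun l p" "\<And>x. x \<in> interior (fst i) \<Longrightarrow> u x = p x"
          using u K unfolding W_h_def piecewise_polynomial_def by blast
        have "p \<in> L2 (interior (fst i))"
          using polynomial_fun_C_k[OF p(1), of 0] T(2)[OF K]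
          by (intro continuous_L2 lmeasurable_open) auto
        then show ?thesis using L2_cong p(2) by blast
      qed
      note u = this[OF that(1)] this[OF that(2)]
      have m: "monomial_fun (snd i) \<in> L2 (interior (fst i))"
        using T(2)[OF K] by (intro monomial_fun_L2 lmeasurable_open) auto
      show ?thesis
        using l2_inner_add_scaleR_right[OF m u, of c]
        by (simp add: L_def l2_inner_commute[of _ _ "monomial_fun (snd i)"])
    qed
    show "?B w w = 0" if "w \<in> ?W" and L0: "\<And>i. i \<in> \<T> \<times> A \<Longrightarrow> L i w = 0" for w
    proof -
      have "AE x in lebesgue_on \<Omega>. w x = 0"
      proof (rule piecewise_polynomial_moments_zero[OF \<Omega>(1) \<T>])
        show "piecewise_polynomial \<T> l w" using that(1) by (simp add: W_h_def)
        show "l2_inner (interior K) w (monomial_fun \<alpha>) = 0"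
          if "K \<in> \<T>" "\<alpha> \<in> Basis \<rightarrow>\<^sub>E UNIV" "(\<Sum>b\<in>Basis. \<alpha> b) \<le> l" for K \<alpha>
          using L0[of "(K, \<alpha>)"] that by (simp add: L_def A_def)
      qed
      then show ?thesis using null that(1) by blast
    qed
  qed (use zero_in_W_h W_h_add_scale F F_null null l2_inner_commute in blast)+
qed

text \<open>Existence of a projection is what gives the \<open>SOME\<close> in \<open>P_h\<close>
  its defining property. The degree \<open>k\<close> is kept apart from \<open>l\<close>: the
  elements of \<open>V_h0\<close> are quadratic even when \<open>l = 1\<close>.\<close>

lemma P_h_projection:
  assumes "piecewise_polynomial \<T> k v"
  shows "P_h \<Omega> \<T> l v \<in> W_h \<Omega> \<T> l"
    and "\<eta> \<in> W_h \<Omega> \<T> l \<Longrightarrow>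
      l2_inner \<Omega> (grad \<Omega> (P_h \<Omega> \<T> l v)) (grad \<Omega> \<eta>) = l2_inner \<Omega> (grad_h \<T> v) (grad \<Omega> \<eta>)"
proof -
  have "\<exists>p\<in>W_h \<Omega> \<T> l. \<forall>\<eta>\<in>W_h \<Omega> \<T> l.
      l2_inner \<Omega> (grad \<Omega> p) (grad \<Omega> \<eta>) = l2_inner \<Omega> (grad_h \<T> v) (grad \<Omega> \<eta>)"
    by (rule W_h_Riesz_representation)
       (use l2_inner_grad_add_scale[OF grad_h_L2[OF \<Omega>(1) \<T> assms]]
          W_h_AE_zero_iff_grad l2_inner_AE_zero in blast)+
  then have "\<exists>p. p \<in> W_h \<Omega> \<T> l \<and> (\<forall>\<eta>\<in>W_h \<Omega> \<T> l.
      l2_inner \<Omega> (grad \<Omega> p) (grad \<Omega> \<eta>) = l2_inner \<Omega> (grad_h \<T> v) (grad \<Omega> \<eta>))"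
    by blast
  from someI_ex[OF this]
  show "P_h \<Omega> \<T> l v \<in> W_h \<Omega> \<T> l" "\<eta> \<in> W_h \<Omega> \<T> l \<Longrightarrow>
      l2_inner \<Omega> (grad \<Omega> (P_h \<Omega> \<T> l v)) (grad \<Omega> \<eta>) = l2_inner \<Omega> (grad_h \<T> v) (grad \<Omega> \<eta>)"
    unfolding P_h_def by blast+
qed

lemma discrete_Poisson_solvable:
  assumes "f \<in> L2 \<Omega>"
  shows "\<exists>w\<in>W_h \<Omega> \<T> l. \<forall>\<eta>\<in>W_h \<Omega> \<T> l. l2_inner \<Omega> (grad \<Omega> w) (grad \<Omega> \<eta>) = l2_inner \<Omega> f \<eta>"
proof (rule W_h_Riesz_representation)
  show "l2_inner \<Omega> f (\<lambda>x. v x + c * w x) = l2_inner \<Omega> f v + c * l2_inner \<Omega> f w"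
    if "v \<in> W_h \<Omega> \<T> l" "w \<in> W_h \<Omega> \<T> l" for v w c
    using l2_inner_add_scaleR_right[OF assms W_h_H1(2)[OF that(1)] W_h_H1(2)[OF that(2)], of c] by simp
qed (rule l2_inner_AE_zero)

lemma load_of_P_h:
  assumes w: "w \<in> W_h \<Omega> \<T> l"
      "\<And>\<eta>. \<eta> \<in> W_h \<Omega> \<T> l \<Longrightarrow> l2_inner \<Omega> (grad \<Omega> w) (grad \<Omega> \<eta>) = l2_inner \<Omega> f \<eta>"
    and v: "piecewise_polynomial \<T> k v"
  shows "l2_inner \<Omega> f (P_h \<Omega> \<T> l v) = l2_inner \<Omega> (grad \<Omega> w) (grad_h \<T> v)"
proof -
  note P = P_h_projection[OF v]
  have "l2_inner \<Omega> f (P_h \<Omega> \<T> l v) = l2_inner \<Omega> (grad \<Omega> (P_h \<Omega> \<T> l v)) (grad \<Omega> w)"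
    using w(2)[OF P(1)] by (simp add: l2_inner_commute)
  also have "\<dots> = l2_inner \<Omega> (grad \<Omega> w) (grad_h \<T> v)"
    using P(2)[OF w(1)] by (simp add: l2_inner_commute)
  finally show ?thesis .
qed

end

theorem lemma5p1:
  fixes \<Omega> :: "'a::euclidean_space set" and \<T> :: "'a set set"
    and f u :: "'a \<Rightarrow> real" and \<epsilon> \<gamma> :: real and l :: nat
  assumes "DIM('a) \<ge> 2"
    and "open \<Omega>" "\<Omega> \<noteq> {}" "convex \<Omega>" "bounded \<Omega>" "polytope (closure \<Omega>)"
    and "f \<in> L2 \<Omega>" and "\<epsilon> > 0"
    and "simplicial_triangulation \<Omega> \<T>" "shape_regular \<gamma> \<T>"
    and "l \<in> {1, 2}"
  shows "MWX_solution \<Omega> \<T> l \<epsilon> f u \<longleftrightarrow> (\<exists>w. decoupled_solution \<Omega> \<T> l \<epsilon> f w u)"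
proof -
  note \<Omega> = assms(2,5,9)
  have poly: "piecewise_polynomial \<T> 2 v" if "v \<in> V_h0 \<Omega> \<T>" for v
    using that by (simp add: V_h0_def V_h_def MWX_space_def)
  \<comment> \<open>Supplies the witness for the forward implication; the converse works with the
    \<open>w\<close> of the given decoupled solution.\<close>
  obtain w where w: "w \<in> W_h \<Omega> \<T> l"
      "\<And>\<eta>. \<eta> \<in> W_h \<Omega> \<T> l \<Longrightarrow> l2_inner \<Omega> (grad \<Omega> w) (grad \<Omega> \<eta>) = l2_inner \<Omega> f \<eta>"
    using discrete_Poisson_solvable[OF \<Omega> assms(7)] by blast
  show ?thesis
  proof
    assume "MWX_solution \<Omega> \<T> l \<epsilon> f u"
    then have "decoupled_solution \<Omega> \<T> l \<epsilon> f w u"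
      using w load_of_P_h[OF \<Omega> w poly] by (simp add: MWX_solution_def decoupled_solution_def)
    then show "\<exists>w. decoupled_solution \<Omega> \<T> l \<epsilon> f w u" by blast
  next
    assume "\<exists>w. decoupled_solution \<Omega> \<T> l \<epsilon> f w u"
    then show "MWX_solution \<Omega> \<T> l \<epsilon> f u"
      using load_of_P_h[OF \<Omega> _ _ poly] by (fastforce simp: MWX_solution_def decoupled_solution_def)
  qed
qed

end
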